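(* For every finite group $G$, there exists an $\mathcal{R}_1$-injective special inverse monoid with trivial group of units and with a maximal subgroup isomorphic to $G$.
   Context: An inverse monoid presentation $\langle X \mid R\rangle$ defines the quotient of the free inverse monoid on $X$ by the congruence generated by $R$. The presentation is special if every defining relation has the form $r=1$ with $r$ a word over $X^{\pm1} = X \cup \{x^{-1} : x \in X\}$; an inverse monoid is special if it admits a special inverse monoid presentation. $\mathcal{R}_1$ denotes the Green's $\mathcal{R}$-class of the identity element $1$ of an inverse monoid $M$, that is, $\mathcal{R}_1=\{m\in M : mm^{-1}=1\}$. Let $\sigma$ be the least group congruence on $M$ ($s \mathrel{\sigma} t$ iff $es=et$ for some idempotent $e$). $M$ is called $\mathcal{R}_1$-injective if the natural morphism $M\to M/\sigma$ onto the maximal group image is injective when restricted to $\mathcal{R}_1$. The maximal subgroups of $M$ are exactly the group $\mathcal{H}$-classes, i.e. the $\mathcal{H}$-classes of idempotents; the group of units is the $\mathcal{H}$-class of $1$. *)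

theory Defs
  imports "HOL-Algebra.Group"
begin

section \<open>Congruences and quotients of monoids\<close>

definition monoid_congruence :: "('a, 'b) monoid_scheme \<Rightarrow> ('a \<times> 'a) set \<Rightarrow> bool" where
  "monoid_congruence M \<rho> \<longleftrightarrow> equiv (carrier M) \<rho> \<and>
     (\<forall>a b c. (a, b) \<in> \<rho> \<and> c \<in> carrier M \<longrightarrow>
        (a \<otimes>\<^bsub>M\<^esub> c, b \<otimes>\<^bsub>M\<^esub> c) \<in> \<rho> \<and> (c \<otimes>\<^bsub>M\<^esub> a, c \<otimes>\<^bsub>M\<^esub> b) \<in> \<rho>)"

definition congruence_generated_by ::
  "('a, 'b) monoid_scheme \<Rightarrow> ('a \<times> 'a) set \<Rightarrow> ('a \<times> 'a) set" where
  "congruence_generated_by M S = \<Inter>{\<rho>. monoid_congruence M \<rho> \<and> S \<subseteq> \<rho>}"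

definition quotient_monoid :: "('a, 'b) monoid_scheme \<Rightarrow> ('a \<times> 'a) set \<Rightarrow> 'a set monoid" where
  "quotient_monoid M \<rho> =
     \<lparr>carrier = carrier M // \<rho>,
      mult = (\<lambda>A B. \<Union>a\<in>A. \<Union>b\<in>B. \<rho> `` {a \<otimes>\<^bsub>M\<^esub> b}),
      one = \<rho> `` {\<one>\<^bsub>M\<^esub>}\<rparr>"

lemma quotient_monoid_mult:
  assumes M: "monoid M" and c: "monoid_congruence M \<rho>"
    and a: "a \<in> carrier M" and b: "b \<in> carrier M"
  shows "\<rho> `` {a} \<otimes>\<^bsub>quotient_monoid M \<rho>\<^esub> \<rho> `` {b} = \<rho> `` {a \<otimes>\<^bsub>M\<^esub> b}"
proof -
  have eq: "equiv (carrier M) \<rho>" using c by (simp add: monoid_congruence_def)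
  have *: "\<rho> `` {x \<otimes>\<^bsub>M\<^esub> y} = \<rho> `` {a \<otimes>\<^bsub>M\<^esub> b}" if x: "(a, x) \<in> \<rho>" and y: "(b, y) \<in> \<rho>" for x y
  proof -
    have "x \<in> carrier M" using eq x by (auto simp: equiv_def)
    then have "(x \<otimes>\<^bsub>M\<^esub> b, x \<otimes>\<^bsub>M\<^esub> y) \<in> \<rho>" using c y by (simp add: monoid_congruence_def)
    moreover have "(a \<otimes>\<^bsub>M\<^esub> b, x \<otimes>\<^bsub>M\<^esub> b) \<in> \<rho>" using c x b by (simp add: monoid_congruence_def)
    ultimately have "(a \<otimes>\<^bsub>M\<^esub> b, x \<otimes>\<^bsub>M\<^esub> y) \<in> \<rho>" using eq by (auto simp: equiv_def dest: transD)
    then show ?thesis using equiv_class_eq[OF eq] by metis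
  qed
  have "(\<Union>x\<in>\<rho> `` {a}. \<Union>y\<in>\<rho> `` {b}. \<rho> `` {x \<otimes>\<^bsub>M\<^esub> y}) =
      (\<Union>x\<in>\<rho> `` {a}. \<Union>y\<in>\<rho> `` {b}. \<rho> `` {a \<otimes>\<^bsub>M\<^esub> b})"
    by (intro SUP_cong refl *) simp_all
  also have "\<dots> = \<rho> `` {a \<otimes>\<^bsub>M\<^esub> b}"
    using equiv_class_self[OF eq a] equiv_class_self[OF eq b] by blast
  finally show ?thesis by (simp add: quotient_monoid_def)
qed

lemma quotient_monoid_monoid:
  assumes M: "monoid M" and c: "monoid_congruence M \<rho>"
  shows "monoid (quotient_monoid M \<rho>)"
proof -
  interpret monoid M by fact
  note qm = quotient_monoid_mult[OF M c]
  let ?Q = "quotient_monoid M \<rho>"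
  have car: "carrier ?Q = carrier M // \<rho>" and one: "\<one>\<^bsub>?Q\<^esub> = \<rho> `` {\<one>\<^bsub>M\<^esub>}"
    by (simp_all add: quotient_monoid_def)
  have rep: "\<exists>a\<in>carrier M. A = \<rho> `` {a}" if "A \<in> carrier ?Q" for A
    using that unfolding car by (auto elim: quotientE)
  have cls: "\<rho> `` {a} \<in> carrier ?Q" if "a \<in> carrier M" for a
    using that unfolding car by (auto intro: quotientI)
  show ?thesis
  proof (rule monoidI)
    fix A B assume "A \<in> carrier ?Q" "B \<in> carrier ?Q"
    then obtain a b where "a \<in> carrier M" "b \<in> carrier M" "A = \<rho> `` {a}" "B = \<rho> `` {b}"
      using rep by metis
    then show "A \<otimes>\<^bsub>?Q\<^esub> B \<in> carrier ?Q" by (simp add: qm cls)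
  next
    show "\<one>\<^bsub>?Q\<^esub> \<in> carrier ?Q" by (simp add: one cls)
  next
    fix A B C assume "A \<in> carrier ?Q" "B \<in> carrier ?Q" "C \<in> carrier ?Q"
    then obtain a b c where "a \<in> carrier M" "b \<in> carrier M" "c \<in> carrier M"
      "A = \<rho> `` {a}" "B = \<rho> `` {b}" "C = \<rho> `` {c}"
      using rep by metis
    then show "A \<otimes>\<^bsub>?Q\<^esub> B \<otimes>\<^bsub>?Q\<^esub> C = A \<otimes>\<^bsub>?Q\<^esub> (B \<otimes>\<^bsub>?Q\<^esub> C)"
      by (simp add: qm m_assoc)
  next
    fix A assume "A \<in> carrier ?Q"
    then obtain a where "a \<in> carrier M" "A = \<rho> `` {a}" using rep by metis
    then show "\<one>\<^bsub>?Q\<^esub> \<otimes>\<^bsub>?Q\<^esub> A = A" "A \<otimes>\<^bsub>?Q\<^esub> \<one>\<^bsub>?Q\<^esub> = A"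
      by (simp_all add: one qm)
  qed
qed


section \<open>Inverse monoids\<close>

locale inverse_monoid = monoid M for M (structure) +
  assumes unique_inverse:
    "x \<in> carrier M \<Longrightarrow> \<exists>!y. y \<in> carrier M \<and> x \<otimes> y \<otimes> x = x \<and> y \<otimes> x \<otimes> y = y"

definition minv :: "('a, 'b) monoid_scheme \<Rightarrow> 'a \<Rightarrow> 'a" where
  "minv M x = (THE y. y \<in> carrier M \<and> x \<otimes>\<^bsub>M\<^esub> y \<otimes>\<^bsub>M\<^esub> x = x \<and> y \<otimes>\<^bsub>M\<^esub> x \<otimes>\<^bsub>M\<^esub> y = y)"

definition idempotents :: "('a, 'b) monoid_scheme \<Rightarrow> 'a set" where
  "idempotents M = {e \<in> carrier M. e \<otimes>\<^bsub>M\<^esub> e = e}"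

definition Green_R :: "('a, 'b) monoid_scheme \<Rightarrow> ('a \<times> 'a) set" where
  "Green_R M = {(x, y). x \<in> carrier M \<and> y \<in> carrier M \<and>
     (\<lambda>m. x \<otimes>\<^bsub>M\<^esub> m) ` carrier M = (\<lambda>m. y \<otimes>\<^bsub>M\<^esub> m) ` carrier M}"

definition Green_L :: "('a, 'b) monoid_scheme \<Rightarrow> ('a \<times> 'a) set" where
  "Green_L M = {(x, y). x \<in> carrier M \<and> y \<in> carrier M \<and>
     (\<lambda>m. m \<otimes>\<^bsub>M\<^esub> x) ` carrier M = (\<lambda>m. m \<otimes>\<^bsub>M\<^esub> y) ` carrier M}"

definition Green_H :: "('a, 'b) monoid_scheme \<Rightarrow> ('a \<times> 'a) set" where
  "Green_H M = Green_R M \<inter> Green_L M"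

definition R1_class :: "('a, 'b) monoid_scheme \<Rightarrow> 'a set" where
  "R1_class M = Green_R M `` {\<one>\<^bsub>M\<^esub>}"

text \<open>The maximal subgroup of \<open>M\<close> at the idempotent \<open>e\<close>.\<close>

definition maximal_subgroup :: "('a, 'b) monoid_scheme \<Rightarrow> 'a \<Rightarrow> 'a monoid" where
  "maximal_subgroup M e = \<lparr>carrier = Green_H M `` {e}, mult = mult M, one = e\<rparr>"

definition least_group_congruence :: "('a, 'b) monoid_scheme \<Rightarrow> ('a \<times> 'a) set" where
  "least_group_congruence M =
     \<Inter>{\<rho>. monoid_congruence M \<rho> \<and> group (quotient_monoid M \<rho>)}"

definition R1_injective :: "('a, 'b) monoid_scheme \<Rightarrow> bool" where
  "R1_injective M \<longleftrightarrow> inj_on (\<lambda>m. least_group_congruence M `` {m}) (R1_class M)"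


section \<open>Special inverse monoid presentations\<close>

text \<open>
  A word over \<open>X\<^sup>\<plusminus>\<^sup>1\<close> is a list of pairs, with \<open>(x, True)\<close> standing for the generator \<open>x\<close> and
  \<open>(x, False)\<close> for its formal inverse.
\<close>

type_synonym 'x word = "('x \<times> bool) list"

definition words :: "'x set \<Rightarrow> 'x word set" where
  "words X = lists (X \<times> UNIV)"

definition word_inverse :: "'x word \<Rightarrow> 'x word" where
  "word_inverse w = rev (map (\<lambda>(x, b). (x, \<not> b)) w)"

definition word_monoid :: "'x set \<Rightarrow> 'x word monoid" where
  "word_monoid X = \<lparr>carrier = words X, mult = (@), one = []\<rparr>"

text \<open>The defining relations of the Vagner congruence.\<close>

definition Vagner_relations :: "'x set \<Rightarrow> ('x word \<times> 'x word) set" where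
  "Vagner_relations X =
     {(u @ word_inverse u @ u, u) | u. u \<in> words X} \<union>
     {(u @ word_inverse u @ v @ word_inverse v, v @ word_inverse v @ u @ word_inverse u)
        | u v. u \<in> words X \<and> v \<in> words X}"

definition Vagner_congruence :: "'x set \<Rightarrow> ('x word \<times> 'x word) set" where
  "Vagner_congruence X = congruence_generated_by (word_monoid X) (Vagner_relations X)"

definition free_inverse_monoid :: "'x set \<Rightarrow> 'x word set monoid" where
  "free_inverse_monoid X = quotient_monoid (word_monoid X) (Vagner_congruence X)"

text \<open>
  A relation \<open>u = v\<close> is a pair of words; it is imposed on the free inverse monoid by identifying
  the elements that \<open>u\<close> and \<open>v\<close> represent there.
\<close>

definition presented_inverse_monoid ::
  "'x set \<Rightarrow> ('x word \<times> 'x word) set \<Rightarrow> 'x word set set monoid" where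
  "presented_inverse_monoid X R =
     quotient_monoid (free_inverse_monoid X)
       (congruence_generated_by (free_inverse_monoid X)
          {(Vagner_congruence X `` {u}, Vagner_congruence X `` {v}) | u v. (u, v) \<in> R})"

definition special_presentation :: "'x set \<Rightarrow> ('x word \<times> 'x word) set \<Rightarrow> bool" where
  "special_presentation X R \<longleftrightarrow> R \<subseteq> words X \<times> {[]}"

text \<open>
  Since HOL cannot quantify over types inside a formula, the type \<open>'x\<close> from which the generators
  are drawn is an explicit parameter.
\<close>

definition special_inverse_monoid :: "'x itself \<Rightarrow> ('a, 'b) monoid_scheme \<Rightarrow> bool" where
  "special_inverse_monoid T M \<longleftrightarrow> inverse_monoid M \<and>
     (\<exists>(X :: 'x set) R. special_presentation X R \<and> presented_inverse_monoid X R \<cong> M)"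


section \<open>Agreement with the usual descriptions\<close>

lemma Green_H_one:
  assumes "monoid M"
  shows "Green_H M `` {\<one>\<^bsub>M\<^esub>} = Units M"
proof -
  interpret monoid M by fact
  have im: "(\<lambda>m. \<one>\<^bsub>M\<^esub> \<otimes>\<^bsub>M\<^esub> m) ` carrier M = carrier M" "(\<lambda>m. m \<otimes>\<^bsub>M\<^esub> \<one>\<^bsub>M\<^esub>) ` carrier M = carrier M"
    by (auto simp: image_iff)
  show ?thesis
  proof (intro Set.set_eqI iffI)
    fix x assume "x \<in> Green_H M `` {\<one>\<^bsub>M\<^esub>}"
    then have x: "x \<in> carrier M" and "\<one>\<^bsub>M\<^esub> \<in> (\<lambda>m. x \<otimes>\<^bsub>M\<^esub> m) ` carrier M"
      "\<one>\<^bsub>M\<^esub> \<in> (\<lambda>m. m \<otimes>\<^bsub>M\<^esub> x) ` carrier M"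
      using im by (auto simp: Green_H_def Green_R_def Green_L_def)
    then obtain y z where y: "y \<in> carrier M" "x \<otimes>\<^bsub>M\<^esub> y = \<one>\<^bsub>M\<^esub>" and z: "z \<in> carrier M" "z \<otimes>\<^bsub>M\<^esub> x = \<one>\<^bsub>M\<^esub>"
      by auto
    then have "z = y" using inv_unique x by blast
    then show "x \<in> Units M" using x y z by (auto simp: Units_def)
  next
    fix x assume x: "x \<in> Units M"
    have "(\<lambda>m. x \<otimes>\<^bsub>M\<^esub> m) ` carrier M = carrier M"
    proof (intro equalityI subsetI)
      fix m assume m: "m \<in> carrier M"
      have "m = x \<otimes>\<^bsub>M\<^esub> (inv\<^bsub>M\<^esub> x \<otimes>\<^bsub>M\<^esub> m)" using x m by (simp add: m_assoc[symmetric] Units_closed)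
      then show "m \<in> (\<lambda>m. x \<otimes>\<^bsub>M\<^esub> m) ` carrier M" using x m by blast
    qed (use x in auto)
    moreover have "(\<lambda>m. m \<otimes>\<^bsub>M\<^esub> x) ` carrier M = carrier M"
    proof (intro equalityI subsetI)
      fix m assume m: "m \<in> carrier M"
      have "m = (m \<otimes>\<^bsub>M\<^esub> inv\<^bsub>M\<^esub> x) \<otimes>\<^bsub>M\<^esub> x" using x m by (simp add: m_assoc Units_closed)
      then show "m \<in> (\<lambda>m. m \<otimes>\<^bsub>M\<^esub> x) ` carrier M" using x m by blast
    qed (use x in auto)
    ultimately show "x \<in> Green_H M `` {\<one>\<^bsub>M\<^esub>}"
      using im x by (auto simp: Green_H_def Green_R_def Green_L_def)
  qed
qed

context inverse_monoid
begin

lemma minv: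
  assumes "x \<in> carrier M"
  shows "minv M x \<in> carrier M" "x \<otimes> minv M x \<otimes> x = x" "minv M x \<otimes> x \<otimes> minv M x = minv M x"
  using theI'[OF unique_inverse[OF assms]] unfolding minv_def by auto

lemma minv_unique:
  assumes "x \<in> carrier M" "y \<in> carrier M" "x \<otimes> y \<otimes> x = x" "y \<otimes> x \<otimes> y = y"
  shows "minv M x = y"
  using unique_inverse[OF assms(1)] minv[OF assms(1)] assms by blast

lemma idem_closed: "e \<in> idempotents M \<Longrightarrow> e \<in> carrier M"
  and idem: "e \<in> idempotents M \<Longrightarrow> e \<otimes> e = e"
  by (auto simp: idempotents_def)

lemma idem_mult:
  assumes "e \<in> idempotents M" "f \<in> idempotents M"
  shows "e \<otimes> f \<in> idempotents M"
proof -
  have e: "e \<in> carrier M" "e \<otimes> e = e" and f: "f \<in> carrier M" "f \<otimes> f = f"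
    using assms by (auto simp: idempotents_def)
  define x where "x = minv M (e \<otimes> f)"
  have x: "x \<in> carrier M" "e \<otimes> f \<otimes> x \<otimes> (e \<otimes> f) = e \<otimes> f" "x \<otimes> (e \<otimes> f) \<otimes> x = x"
    using minv[of "e \<otimes> f"] e f by (auto simp: x_def)
  have e': "e \<otimes> (e \<otimes> z) = e \<otimes> z" if "z \<in> carrier M" for z using that e by (simp add: m_assoc[symmetric])
  have f': "f \<otimes> (f \<otimes> z) = f \<otimes> z" if "z \<in> carrier M" for z using that f by (simp add: m_assoc[symmetric])
  have x': "x \<otimes> (e \<otimes> (f \<otimes> (x \<otimes> z))) = x \<otimes> z" if "z \<in> carrier M" for z
  proof -
    have "x \<otimes> (e \<otimes> (f \<otimes> (x \<otimes> z))) = (x \<otimes> (e \<otimes> f) \<otimes> x) \<otimes> z"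
      using that e f x(1) by (simp add: m_assoc)
    then show ?thesis by (simp add: x)
  qed
  have "minv M (e \<otimes> f) = f \<otimes> x \<otimes> e"
    by (rule minv_unique) (use e f x in \<open>simp_all add: m_assoc e' f' x'\<close>)
  then have fxe: "f \<otimes> (x \<otimes> e) = x" using e f x by (simp add: x_def m_assoc)
  have "f \<otimes> x \<otimes> e = x" using e f x(1) fxe by (simp add: m_assoc)
  then have "x \<otimes> x = f \<otimes> x \<otimes> e \<otimes> (f \<otimes> x \<otimes> e)" by simp
  also have "\<dots> = f \<otimes> (x \<otimes> e)" using e f x(1) by (simp add: m_assoc x')
  finally have xx: "x \<otimes> x = x" by (simp add: fxe)
  have "minv M x = x" by (rule minv_unique) (simp_all add: x xx)
  moreover have "minv M x = e \<otimes> f" by (rule minv_unique) (use e f x in auto)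
  ultimately show ?thesis using xx x(1) by (simp add: idempotents_def)
qed

lemma idem_commute:
  assumes "e \<in> idempotents M" "f \<in> idempotents M"
  shows "e \<otimes> f = f \<otimes> e"
proof -
  have e: "e \<in> carrier M" "e \<otimes> e = e" and f: "f \<in> carrier M" "f \<otimes> f = f"
    using assms by (auto simp: idempotents_def)
  have ef: "e \<otimes> f \<otimes> (e \<otimes> f) = e \<otimes> f" and fe: "f \<otimes> e \<otimes> (f \<otimes> e) = f \<otimes> e"
    using idem_mult assms by (auto intro: idem)
  have e': "e \<otimes> (e \<otimes> z) = e \<otimes> z" if "z \<in> carrier M" for z using that e by (simp add: m_assoc[symmetric])
  have f': "f \<otimes> (f \<otimes> z) = f \<otimes> z" if "z \<in> carrier M" for z using that f by (simp add: m_assoc[symmetric])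
  have "minv M (e \<otimes> f) = e \<otimes> f" by (rule minv_unique) (use e f ef in auto)
  moreover have "minv M (e \<otimes> f) = f \<otimes> e"
    by (rule minv_unique) (use e f ef fe in \<open>simp_all add: m_assoc e' f'\<close>)
  ultimately show ?thesis by simp
qed

lemma R1_class_eq: "R1_class M = {m \<in> carrier M. m \<otimes> minv M m = \<one>}"
proof -
  have im: "(\<lambda>m. \<one> \<otimes> m) ` carrier M = carrier M" by (auto simp: image_iff)
  show ?thesis
  proof (intro Set.set_eqI iffI)
    fix x assume "x \<in> R1_class M"
    then have x: "x \<in> carrier M" and "\<one> \<in> (\<lambda>m. x \<otimes> m) ` carrier M"
      using im by (auto simp: R1_class_def Green_R_def)
    then obtain y where y: "y \<in> carrier M" "x \<otimes> y = \<one>" by auto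
    have "minv M x = y" by (rule minv_unique) (use x y in \<open>simp_all add: m_assoc\<close>)
    then show "x \<in> {m \<in> carrier M. m \<otimes> minv M m = \<one>}" using x y by simp
  next
    fix x assume "x \<in> {m \<in> carrier M. m \<otimes> minv M m = \<one>}"
    then have x: "x \<in> carrier M" "x \<otimes> minv M x = \<one>" by auto
    have "(\<lambda>m. x \<otimes> m) ` carrier M = carrier M"
    proof (intro equalityI subsetI)
      fix m assume m: "m \<in> carrier M"
      have "m = x \<otimes> (minv M x \<otimes> m)" using x m minv(1) by (simp add: m_assoc[symmetric])
      then show "m \<in> (\<lambda>m. x \<otimes> m) ` carrier M" using x m minv(1) by blast
    qed (use x in auto)
    then show "x \<in> R1_class M" using im x by (auto simp: R1_class_def Green_R_def)
  qed
qed

lemma least_group_congruence_eq: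
  "least_group_congruence M =
     {(s, t). s \<in> carrier M \<and> t \<in> carrier M \<and> (\<exists>e\<in>idempotents M. e \<otimes> s = e \<otimes> t)}"
    (is "_ = ?S")
proof
  have mon: "monoid M" by (rule monoid_axioms)
  have sym: "sym ?S" by (rule symI, clarify) metis
  have "\<one> \<in> idempotents M" by (simp add: idempotents_def)
  then have refl: "refl_on (carrier M) ?S" unfolding refl_on_def by blast
  have trans: "trans ?S"
  proof (rule transI, clarify)
    fix s t u e f
    assume c: "s \<in> carrier M" "t \<in> carrier M" "u \<in> carrier M"
      and e: "e \<in> idempotents M" "e \<otimes> s = e \<otimes> t" and f: "f \<in> idempotents M" "f \<otimes> t = f \<otimes> u"
    note ec = idem_closed[OF e(1)] and fc = idem_closed[OF f(1)]
    have "f \<otimes> e \<otimes> s = f \<otimes> e \<otimes> t" using c ec fc e by (simp add: m_assoc)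
    also have "\<dots> = e \<otimes> f \<otimes> t" using idem_commute e f by simp
    also have "\<dots> = e \<otimes> f \<otimes> u" using c ec fc f by (simp add: m_assoc)
    also have "\<dots> = f \<otimes> e \<otimes> u" using idem_commute e f by simp
    finally show "\<exists>e\<in>idempotents M. e \<otimes> s = e \<otimes> u" using idem_mult e f by blast
  qed
  have eqv: "equiv (carrier M) ?S" using sym refl trans by (auto intro!: equivI)
  have right: "(s \<otimes> c, t \<otimes> c) \<in> ?S" if st: "(s, t) \<in> ?S" and c: "c \<in> carrier M" for s t c
  proof -
    obtain e where e: "e \<in> idempotents M" "e \<otimes> s = e \<otimes> t" and cc: "s \<in> carrier M" "t \<in> carrier M"
      using st by auto
    have "e \<otimes> (s \<otimes> c) = e \<otimes> (t \<otimes> c)"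
      using c cc e idem_closed[OF e(1)] by (simp add: m_assoc[symmetric])
    then show ?thesis using e c cc by auto
  qed
  have left: "(c \<otimes> s, c \<otimes> t) \<in> ?S" if st: "(s, t) \<in> ?S" and c: "c \<in> carrier M" for s t c
  proof -
    obtain e where e: "e \<in> idempotents M" "e \<otimes> s = e \<otimes> t" and cc: "s \<in> carrier M" "t \<in> carrier M"
      using st by auto
    note ec = idem_closed[OF e(1)]
    let ?d = "minv M c"
    have d: "?d \<in> carrier M" "c \<otimes> ?d \<otimes> c = c" "?d \<otimes> c \<otimes> ?d = ?d" using minv[OF c] by auto
    have di: "?d \<otimes> c \<in> idempotents M" using c d by (simp add: idempotents_def m_assoc[symmetric])
    have push: "(c \<otimes> e \<otimes> ?d) \<otimes> (c \<otimes> x) = c \<otimes> (e \<otimes> x)" if x: "x \<in> carrier M" for x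
    proof -
      have "(c \<otimes> e \<otimes> ?d) \<otimes> (c \<otimes> x) = c \<otimes> (e \<otimes> (?d \<otimes> c)) \<otimes> x"
        using c d ec x by (simp add: m_assoc)
      also have "\<dots> = c \<otimes> (?d \<otimes> c \<otimes> e) \<otimes> x" using idem_commute[OF e(1) di] by simp
      also have "\<dots> = (c \<otimes> ?d \<otimes> c) \<otimes> (e \<otimes> x)" using c d(1) ec x by (simp add: m_assoc)
      finally show ?thesis by (simp add: d)
    qed
    have "(c \<otimes> e \<otimes> ?d) \<otimes> (c \<otimes> e \<otimes> ?d) = (c \<otimes> e \<otimes> ?d) \<otimes> (c \<otimes> (e \<otimes> ?d))"
      using c d(1) ec by (simp add: m_assoc)
    also have "\<dots> = c \<otimes> (e \<otimes> (e \<otimes> ?d))" using d(1) ec by (intro push) simp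
    also have "\<dots> = c \<otimes> (e \<otimes> e) \<otimes> ?d" using c d(1) ec by (simp add: m_assoc)
    also have "\<dots> = c \<otimes> e \<otimes> ?d" by (simp add: idem[OF e(1)])
    finally have "c \<otimes> e \<otimes> ?d \<in> idempotents M" using c d(1) ec by (simp add: idempotents_def)
    moreover have "(c \<otimes> e \<otimes> ?d) \<otimes> (c \<otimes> s) = (c \<otimes> e \<otimes> ?d) \<otimes> (c \<otimes> t)" using push cc e by simp
    ultimately show ?thesis using c cc by auto
  qed
  have cong: "monoid_congruence M ?S"
    unfolding monoid_congruence_def using eqv left right by blast
  have "group (quotient_monoid M ?S)"
  proof (rule monoid.group_l_invI[OF quotient_monoid_monoid[OF mon cong]])
    fix A assume "A \<in> carrier (quotient_monoid M ?S)"
    then obtain a where a: "a \<in> carrier M" "A = ?S `` {a}"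
      by (auto simp: quotient_monoid_def elim: quotientE)
    let ?d = "minv M a"
    have d: "?d \<in> carrier M" "?d \<otimes> a \<otimes> ?d = ?d" using minv[OF a(1)] by auto
    have di: "?d \<otimes> a \<in> idempotents M" using a d by (simp add: idempotents_def m_assoc[symmetric])
    have "(?d \<otimes> a, \<one>) \<in> ?S"
      using di idem[OF di] idem_closed[OF di] by (auto intro!: bexI[OF _ di])
    then have "?S `` {?d \<otimes> a} = ?S `` {\<one>}" by (rule equiv_class_eq[OF eqv])
    then have "?S `` {?d} \<otimes>\<^bsub>quotient_monoid M ?S\<^esub> A = \<one>\<^bsub>quotient_monoid M ?S\<^esub>"
      unfolding a(2) quotient_monoid_mult[OF mon cong d(1) a(1)] by (simp add: quotient_monoid_def)
    moreover have "?S `` {?d} \<in> carrier (quotient_monoid M ?S)"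
      using quotientI[OF d(1), of ?S] unfolding quotient_monoid_def partial_object.simps .
    ultimately show "\<exists>B\<in>carrier (quotient_monoid M ?S).
        B \<otimes>\<^bsub>quotient_monoid M ?S\<^esub> A = \<one>\<^bsub>quotient_monoid M ?S\<^esub>" by blast
  qed
  then show "least_group_congruence M \<subseteq> ?S"
    unfolding least_group_congruence_def using cong by blast
  show "?S \<subseteq> least_group_congruence M"
    unfolding least_group_congruence_def
  proof (clarify)
    fix s t e \<rho>
    assume c: "s \<in> carrier M" "t \<in> carrier M" and e: "e \<in> idempotents M" "e \<otimes> s = e \<otimes> t"
      and \<rho>: "monoid_congruence M \<rho>" and gr: "group (quotient_monoid M \<rho>)"
    let ?Q = "quotient_monoid M \<rho>"
    interpret Q: group ?Q by fact
    note qm = quotient_monoid_mult[OF mon \<rho>]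
    note ec = idem_closed[OF e(1)]
    have cls: "\<rho> `` {x} \<in> carrier ?Q" if "x \<in> carrier M" for x
      using that by (simp add: quotient_monoid_def quotientI)
    have "\<rho> `` {e} \<otimes>\<^bsub>?Q\<^esub> \<rho> `` {s} = \<rho> `` {e} \<otimes>\<^bsub>?Q\<^esub> \<rho> `` {t}"
      using c ec e by (simp add: qm)
    then have "\<rho> `` {s} = \<rho> `` {t}" using cls c ec by simp
    moreover have "equiv (carrier M) \<rho>" using \<rho> by (simp add: monoid_congruence_def)
    ultimately show "(s, t) \<in> \<rho>" using c by (metis eq_equiv_class)
  qed
qed

end

end

theory Submission
  imports Defs
begin

text \<open>
  Let \<open>M\<close> be generated by a letter \<open>t\<close> and letters that name elements of \<open>G\<close>, with the relations
  \<open>t w t\<^sup>-\<^sup>1 = 1\<close> for all words \<open>w\<close> in the naming letters whose product in \<open>G\<close> is the identity.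
  Write \<open>a(g)\<close> for a letter naming \<open>g\<close>. The words \<open>w\<close> themselves are not made trivial, so
  no \<open>a(g)\<close> becomes a unit; the relations only say that a copy of the Cayley graph of \<open>G\<close> hangs
  at the end of every edge labelled \<open>t\<close>, in other words that \<open>t u = t v\<close> whenever \<open>u\<close> and \<open>v\<close> have
  the same product (\<open>t_absorbs\<close>). The Schutzenberger graph of \<open>1\<close> is therefore a tree of copies of
  \<open>G\<close>: from the root a \<open>t\<close>-edge leads into a copy of \<open>G\<close>, from each vertex of this copy another
  \<open>t\<close>-edge leads into the next one, and so on. Its vertices are the products \<open>t a(g\<^sub>1) \<dots> t a(g\<^sub>k)\<close>,
  and these are all the right units (\<open>R1_class_climb\<close>).

  In the group \<open>G \<wr> \<int>\<close>, a quotient of \<open>M\<close>, such a product switches the lamps at \<open>1, \<dots>, k\<close> to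
  \<open>g\<^sub>1, \<dots>, g\<^sub>k\<close> and leaves the lamplighter at \<open>k\<close>. The image determines the factors, whence
  \<open>R1_injective_M\<close>; and a product of two such elements is \<open>1\<close> only if \<open>k = 0\<close> for both, whence
  \<open>Units_M\<close>.

  To obtain \<open>G\<close> as a maximal subgroup, take the idempotent \<open>e = \<Prod>g. (t a(g))\<^sup>-\<^sup>1 (t a(g))\<close>, a finite
  product since \<open>G\<close> is finite. Its Schutzenberger graph has a single copy of \<open>G\<close> as its base,
  with a \<open>t\<close>-edge coming into every vertex of the base, and trees as above growing out of the
  base. If \<open>G\<close> is nontrivial, the incoming edges tell the base from all other copies of \<open>G\<close>,
  in which only the identity receives a \<open>t\<close>-edge; so the automorphisms of this graph are exactly
  the translations by \<open>G\<close>. (For trivial \<open>G\<close> the group of units serves instead.) Algebraically,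
  \<open>g \<mapsto> e a(g)\<close> is a homomorphism into the \<open>\<H>\<close>-class of \<open>e\<close> (\<open>embed_mult\<close>, \<open>embed_Green_H\<close>),
  injective already in the lamplighter group (\<open>embed_inj\<close>), and onto (\<open>Green_H_embed\<close>).

  Both graphs enter as actions of \<open>M\<close> by partial injections. Where a word leads from the base
  point is read off the action, and conversely the end point determines the word up to equality
  in \<open>M\<close>, by the normal forms of \<open>spell_run\<close>.
\<close>

section \<open>Inverse monoids and their presentations\<close>

lemma monoid_congruence_generated_by:
  assumes "monoid M" and "S \<subseteq> carrier M \<times> carrier M"
  shows "monoid_congruence M (congruence_generated_by M S)"
proof -
  interpret monoid M by fact
  let ?C = "{\<rho>. monoid_congruence M \<rho> \<and> S \<subseteq> \<rho>}"
  have full: "carrier M \<times> carrier M \<in> ?C"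
    using assms(2) by (auto simp: monoid_congruence_def equiv_def refl_on_def sym_def trans_def)
  have eq: "equiv (carrier M) \<rho>" if "\<rho> \<in> ?C" for \<rho>
    using that by (simp add: monoid_congruence_def)
  have sub: "\<Inter>?C \<subseteq> carrier M \<times> carrier M" using full by blast
  have "refl_on (carrier M) (\<Inter>?C)"
    using eq by (auto simp: equiv_def refl_on_def)
  moreover have "sym (\<Inter>?C)"
    using eq unfolding equiv_def sym_def by blast
  moreover have "trans (\<Inter>?C)"
  proof (rule transI)
    fix x y z assume "(x, y) \<in> \<Inter>?C" "(y, z) \<in> \<Inter>?C"
    then show "(x, z) \<in> \<Inter>?C"
      using eq unfolding equiv_def by (blast dest: transD)
  qed
  ultimately have "equiv (carrier M) (\<Inter>?C)" using sub by (auto intro!: equivI)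
  then show ?thesis
    unfolding congruence_generated_by_def monoid_congruence_def by simp
qed

lemma congruence_generated_by_least:
  "monoid_congruence M \<rho> \<Longrightarrow> S \<subseteq> \<rho> \<Longrightarrow> congruence_generated_by M S \<subseteq> \<rho>"
  unfolding congruence_generated_by_def by blast

lemma congruence_generated_by_superset: "S \<subseteq> congruence_generated_by M S"
  unfolding congruence_generated_by_def by blast

text \<open>
  For an inverse monoid it suffices that the idempotents of one supply \<open>E\<close> commute, if this supply
  contains \<open>x y\<close> and \<open>y x\<close> for some inverse \<open>y\<close> of each \<open>x\<close>. For words the supply is \<open>u u\<^sup>-\<^sup>1\<close>, where
  commutation is a Vagner relation. The reason is that every idempotent \<open>x\<close> lies in \<open>E\<close>: an
  inverse of \<open>x\<close> is the product of \<open>y x\<close> and \<open>x y\<close>, and exchanging these factors gives \<open>x = y x\<close>.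
\<close>

lemma inverse_monoidI_commuting:
  assumes "monoid M"
    and inverses: "\<And>x. x \<in> carrier M \<Longrightarrow> \<exists>y\<in>carrier M. x \<otimes>\<^bsub>M\<^esub> y \<otimes>\<^bsub>M\<^esub> x = x \<and>
      y \<otimes>\<^bsub>M\<^esub> x \<otimes>\<^bsub>M\<^esub> y = y \<and> x \<otimes>\<^bsub>M\<^esub> y \<in> E \<and> y \<otimes>\<^bsub>M\<^esub> x \<in> E"
    and commute: "\<And>e f. e \<in> E \<Longrightarrow> f \<in> E \<Longrightarrow> e \<otimes>\<^bsub>M\<^esub> f = f \<otimes>\<^bsub>M\<^esub> e"
  shows "inverse_monoid M"
proof -
  interpret monoid M by fact
  have idem: "x \<in> E" if x: "x \<in> carrier M" "x \<otimes>\<^bsub>M\<^esub> x = x" for x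
  proof -
    obtain y where y: "y \<in> carrier M" "x \<otimes>\<^bsub>M\<^esub> y \<otimes>\<^bsub>M\<^esub> x = x" "y \<otimes>\<^bsub>M\<^esub> x \<otimes>\<^bsub>M\<^esub> y = y"
      "x \<otimes>\<^bsub>M\<^esub> y \<in> E" "y \<otimes>\<^bsub>M\<^esub> x \<in> E" using inverses[OF x(1)] by blast
    let ?p = "x \<otimes>\<^bsub>M\<^esub> y" and ?q = "y \<otimes>\<^bsub>M\<^esub> x"
    have pq: "?p \<otimes>\<^bsub>M\<^esub> ?q = ?q \<otimes>\<^bsub>M\<^esub> ?p" using commute y by blast
    have "?q \<otimes>\<^bsub>M\<^esub> ?p = y \<otimes>\<^bsub>M\<^esub> (x \<otimes>\<^bsub>M\<^esub> x) \<otimes>\<^bsub>M\<^esub> y" using x(1) y(1) by (simp add: m_assoc)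
    then have qp: "?q \<otimes>\<^bsub>M\<^esub> ?p = y" using x y by simp
    have "x \<otimes>\<^bsub>M\<^esub> y = x \<otimes>\<^bsub>M\<^esub> (?p \<otimes>\<^bsub>M\<^esub> ?q)" using qp pq by simp
    also have "\<dots> = (x \<otimes>\<^bsub>M\<^esub> x) \<otimes>\<^bsub>M\<^esub> y \<otimes>\<^bsub>M\<^esub> (y \<otimes>\<^bsub>M\<^esub> x)" using x(1) y(1) by (simp add: m_assoc)
    also have "\<dots> = y" using qp pq x by simp
    finally have "x \<otimes>\<^bsub>M\<^esub> y = y" .
    then have "y \<otimes>\<^bsub>M\<^esub> x = x" using y by simp
    then show ?thesis using y by simp
  qed
  have uniq: "y = z"
    if x: "x \<in> carrier M" and y: "y \<in> carrier M" "x \<otimes>\<^bsub>M\<^esub> y \<otimes>\<^bsub>M\<^esub> x = x" "y \<otimes>\<^bsub>M\<^esub> x \<otimes>\<^bsub>M\<^esub> y = y"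
      and z: "z \<in> carrier M" "x \<otimes>\<^bsub>M\<^esub> z \<otimes>\<^bsub>M\<^esub> x = x" "z \<otimes>\<^bsub>M\<^esub> x \<otimes>\<^bsub>M\<^esub> z = z" for x y z
  proof -
    have E: "x \<otimes>\<^bsub>M\<^esub> y \<in> E" "x \<otimes>\<^bsub>M\<^esub> z \<in> E" "y \<otimes>\<^bsub>M\<^esub> x \<in> E" "z \<otimes>\<^bsub>M\<^esub> x \<in> E"
      using x y z by (auto intro!: idem simp: m_assoc[symmetric])
    have "y = y \<otimes>\<^bsub>M\<^esub> (x \<otimes>\<^bsub>M\<^esub> z \<otimes>\<^bsub>M\<^esub> x) \<otimes>\<^bsub>M\<^esub> y" using y z by simp
    also have "\<dots> = (y \<otimes>\<^bsub>M\<^esub> x) \<otimes>\<^bsub>M\<^esub> (z \<otimes>\<^bsub>M\<^esub> x) \<otimes>\<^bsub>M\<^esub> y" using x y(1) z(1) by (simp add: m_assoc)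
    also have "\<dots> = (z \<otimes>\<^bsub>M\<^esub> x) \<otimes>\<^bsub>M\<^esub> (y \<otimes>\<^bsub>M\<^esub> x) \<otimes>\<^bsub>M\<^esub> y" using commute E by simp
    also have "\<dots> = z \<otimes>\<^bsub>M\<^esub> x \<otimes>\<^bsub>M\<^esub> (y \<otimes>\<^bsub>M\<^esub> x \<otimes>\<^bsub>M\<^esub> y)" using x y(1) z(1) by (simp add: m_assoc)
    finally have 1: "y = z \<otimes>\<^bsub>M\<^esub> x \<otimes>\<^bsub>M\<^esub> y" using y by simp
    have "z = z \<otimes>\<^bsub>M\<^esub> (x \<otimes>\<^bsub>M\<^esub> y \<otimes>\<^bsub>M\<^esub> x) \<otimes>\<^bsub>M\<^esub> z" using y z by simp
    also have "\<dots> = z \<otimes>\<^bsub>M\<^esub> ((x \<otimes>\<^bsub>M\<^esub> y) \<otimes>\<^bsub>M\<^esub> (x \<otimes>\<^bsub>M\<^esub> z))" using x y(1) z(1) by (simp add: m_assoc)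
    also have "\<dots> = z \<otimes>\<^bsub>M\<^esub> ((x \<otimes>\<^bsub>M\<^esub> z) \<otimes>\<^bsub>M\<^esub> (x \<otimes>\<^bsub>M\<^esub> y))" using commute E by simp
    also have "\<dots> = (z \<otimes>\<^bsub>M\<^esub> x \<otimes>\<^bsub>M\<^esub> z) \<otimes>\<^bsub>M\<^esub> x \<otimes>\<^bsub>M\<^esub> y" using x y(1) z(1) by (simp add: m_assoc)
    finally have "z = z \<otimes>\<^bsub>M\<^esub> x \<otimes>\<^bsub>M\<^esub> y" using z by simp
    with 1 show ?thesis by simp
  qed
  show ?thesis
  proof unfold_locales
    fix x assume x: "x \<in> carrier M"
    then obtain y where "y \<in> carrier M" "x \<otimes>\<^bsub>M\<^esub> y \<otimes>\<^bsub>M\<^esub> x = x" "y \<otimes>\<^bsub>M\<^esub> x \<otimes>\<^bsub>M\<^esub> y = y"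
      using inverses by blast
    then show "\<exists>!y. y \<in> carrier M \<and> x \<otimes>\<^bsub>M\<^esub> y \<otimes>\<^bsub>M\<^esub> x = x \<and> y \<otimes>\<^bsub>M\<^esub> x \<otimes>\<^bsub>M\<^esub> y = y"
      using uniq[OF x] by blast
  qed
qed

text \<open>
  In an inverse monoid each \<open>\<R>\<close>-class contains exactly one idempotent, namely \<open>m m\<^sup>-\<^sup>1\<close>, and dually
  for \<open>\<L>\<close>. This turns membership in a group \<open>\<H>\<close>-class into two equations between words.
\<close>

lemma (in inverse_monoid) Green_R_idempotent:
  assumes "(e, m) \<in> Green_R M" "e \<in> idempotents M"
  shows "m \<otimes> minv M m = e"
proof -
  have e: "e \<in> carrier M" "e \<otimes> e = e" and m: "m \<in> carrier M"
    and im: "(\<lambda>x. e \<otimes> x) ` carrier M = (\<lambda>x. m \<otimes> x) ` carrier M"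
    using assms by (auto simp: Green_R_def idempotents_def)
  note mi = minv[OF m]
  have "m \<in> (\<lambda>x. e \<otimes> x) ` carrier M" unfolding im by (rule image_eqI[of _ _ \<one>]) (use m in auto)
  then obtain x where x: "x \<in> carrier M" "m = e \<otimes> x" by auto
  have em: "e \<otimes> m = m" unfolding x(2) using x(1) e by (simp add: m_assoc[symmetric])
  have "e \<in> (\<lambda>x. m \<otimes> x) ` carrier M"
    unfolding im[symmetric] by (rule image_eqI[of _ _ \<one>]) (use e in auto)
  then obtain y where y: "y \<in> carrier M" "e = m \<otimes> y" by auto
  have "m \<otimes> minv M m \<otimes> e = e"
    unfolding y(2) using m y(1) mi by (simp add: m_assoc[symmetric])
  moreover have "m \<otimes> minv M m \<in> idempotents M"
    using m mi by (auto simp: idempotents_def m_assoc[symmetric])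
  ultimately have "e = e \<otimes> (m \<otimes> minv M m)" using idem_commute assms(2) by metis
  then show ?thesis using em e m mi by (simp add: m_assoc[symmetric])
qed

lemma (in inverse_monoid) Green_L_idempotent:
  assumes "(e, m) \<in> Green_L M" "e \<in> idempotents M"
  shows "minv M m \<otimes> m = e"
proof -
  have e: "e \<in> carrier M" "e \<otimes> e = e" and m: "m \<in> carrier M"
    and im: "(\<lambda>x. x \<otimes> e) ` carrier M = (\<lambda>x. x \<otimes> m) ` carrier M"
    using assms by (auto simp: Green_L_def idempotents_def)
  note mi = minv[OF m]
  have "m \<in> (\<lambda>x. x \<otimes> e) ` carrier M" unfolding im by (rule image_eqI[of _ _ \<one>]) (use m in auto)
  then obtain x where x: "x \<in> carrier M" "m = x \<otimes> e" by auto
  have em: "m \<otimes> e = m" unfolding x(2) using x(1) e by (simp add: m_assoc)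
  have "e \<in> (\<lambda>x. x \<otimes> m) ` carrier M"
    unfolding im[symmetric] by (rule image_eqI[of _ _ \<one>]) (use e in auto)
  then obtain y where y: "y \<in> carrier M" "e = y \<otimes> m" by auto
  have "e \<otimes> (minv M m \<otimes> m) = y \<otimes> (m \<otimes> minv M m \<otimes> m)"
    unfolding y(2) using m y(1) mi(1) by (simp add: m_assoc)
  then have "e \<otimes> (minv M m \<otimes> m) = e" using y mi by simp
  moreover have "minv M m \<otimes> m \<in> idempotents M"
    using m mi by (auto simp: idempotents_def m_assoc[symmetric])
  ultimately have "minv M m \<otimes> m \<otimes> e = e" using idem_commute assms(2) by metis
  then show ?thesis using em e m mi by (simp add: m_assoc)
qed

lemma (in monoid) Green_H_I:
  assumes c: "e \<in> carrier G" "x \<in> carrier G" "y \<in> carrier G"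
    and "x \<otimes> y = e" "y \<otimes> x = e" "e \<otimes> x = x" "x \<otimes> e = x"
  shows "(e, x) \<in> Green_H G"
proof -
  have "(\<lambda>m. e \<otimes> m) ` carrier G \<subseteq> (\<lambda>m. x \<otimes> m) ` carrier G"
  proof (rule image_subsetI)
    fix m assume m: "m \<in> carrier G"
    have "e \<otimes> m = x \<otimes> (y \<otimes> m)" unfolding assms(4)[symmetric] using c m by (simp add: m_assoc)
    then show "e \<otimes> m \<in> (\<lambda>m. x \<otimes> m) ` carrier G" using c m by blast
  qed
  moreover have "(\<lambda>m. x \<otimes> m) ` carrier G \<subseteq> (\<lambda>m. e \<otimes> m) ` carrier G"
  proof (rule image_subsetI)
    fix m assume m: "m \<in> carrier G"
    have "x \<otimes> m = e \<otimes> (x \<otimes> m)" using c m assms(6) by (simp add: m_assoc[symmetric])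
    then show "x \<otimes> m \<in> (\<lambda>m. e \<otimes> m) ` carrier G" using c m by blast
  qed
  moreover have "(\<lambda>m. m \<otimes> e) ` carrier G \<subseteq> (\<lambda>m. m \<otimes> x) ` carrier G"
  proof (rule image_subsetI)
    fix m assume m: "m \<in> carrier G"
    have "m \<otimes> e = (m \<otimes> y) \<otimes> x" unfolding assms(5)[symmetric] using c m by (simp add: m_assoc)
    then show "m \<otimes> e \<in> (\<lambda>m. m \<otimes> x) ` carrier G" using c m by blast
  qed
  moreover have "(\<lambda>m. m \<otimes> x) ` carrier G \<subseteq> (\<lambda>m. m \<otimes> e) ` carrier G"
  proof (rule image_subsetI)
    fix m assume m: "m \<in> carrier G"
    have "m \<otimes> x = (m \<otimes> x) \<otimes> e" using c m assms(7) by (simp add: m_assoc)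
    then show "m \<otimes> x \<in> (\<lambda>m. m \<otimes> e) ` carrier G" using c m by blast
  qed
  ultimately show ?thesis using c by (auto simp: Green_H_def Green_R_def Green_L_def)
qed

lemma word_monoid: "monoid (word_monoid X)"
  by (rule monoidI) (auto simp: word_monoid_def words_def)

lemma word_inverse_simps [simp]:
  "word_inverse [] = []"
  "word_inverse (u @ v) = word_inverse v @ word_inverse u"
  "word_inverse ((x, b) # u) = word_inverse u @ [(x, \<not> b)]"
  "word_inverse (word_inverse u) = u"
  by (auto simp: word_inverse_def rev_map o_def case_prod_unfold)

lemma word_inverse_in_words [simp]: "u \<in> words X \<Longrightarrow> word_inverse u \<in> words X"
  by (induction u) (auto simp: words_def)

lemma append_in_words [simp]: "u @ v \<in> words X \<longleftrightarrow> u \<in> words X \<and> v \<in> words X"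
  by (simp add: words_def)

definition presentation_class ::
  "'x set \<Rightarrow> ('x word \<times> 'x word) set \<Rightarrow> 'x word \<Rightarrow> 'x word set set" where
  "presentation_class X R w =
     congruence_generated_by (free_inverse_monoid X)
       {(Vagner_congruence X `` {u}, Vagner_congruence X `` {v}) | u v. (u, v) \<in> R} ``
       {Vagner_congruence X `` {w}}"

text \<open>
  From here on, computations take place between words, compared by \<open>cl u = cl v\<close>: associativity
  is then that of lists, and inverses are formal.
\<close>

locale inverse_presentation =
  fixes X :: "'x set" and R :: "('x word \<times> 'x word) set"
  assumes relations_over: "R \<subseteq> words X \<times> words X"
begin

abbreviation "M \<equiv> presented_inverse_monoid X R"
abbreviation "cl \<equiv> presentation_class X R"

abbreviation "V \<equiv> Vagner_congruence X"
abbreviation "FR \<equiv> {(V `` {u}, V `` {v}) | u v. (u, v) \<in> R}"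
abbreviation "K \<equiv> congruence_generated_by (free_inverse_monoid X) FR"

lemma V_congruence: "monoid_congruence (word_monoid X) V"
  unfolding Vagner_congruence_def
  by (rule monoid_congruence_generated_by[OF word_monoid])
     (auto simp: Vagner_relations_def word_monoid_def)

lemma V_equiv: "equiv (words X) V"
  using V_congruence by (simp add: monoid_congruence_def word_monoid_def)

lemma free_monoid: "monoid (free_inverse_monoid X)"
  unfolding free_inverse_monoid_def by (rule quotient_monoid_monoid[OF word_monoid V_congruence])

lemma free_carrier: "carrier (free_inverse_monoid X) = (\<lambda>w. V `` {w}) ` words X"
  by (auto simp: free_inverse_monoid_def quotient_monoid_def word_monoid_def quotient_def)

lemma free_mult:
  "u \<in> words X \<Longrightarrow> v \<in> words X \<Longrightarrow>
    V `` {u} \<otimes>\<^bsub>free_inverse_monoid X\<^esub> V `` {v} = V `` {u @ v}"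
  using quotient_monoid_mult[OF word_monoid V_congruence, of u v]
  by (simp add: free_inverse_monoid_def word_monoid_def)

lemma K_congruence: "monoid_congruence (free_inverse_monoid X) K"
  using relations_over
  by (intro monoid_congruence_generated_by[OF free_monoid]) (auto simp: free_carrier)

lemma K_equiv: "equiv (carrier (free_inverse_monoid X)) K"
  using K_congruence by (simp add: monoid_congruence_def)

lemma M_monoid: "monoid M"
  unfolding presented_inverse_monoid_def by (rule quotient_monoid_monoid[OF free_monoid K_congruence])

lemma M_carrier: "carrier M = cl ` words X"
  unfolding presented_inverse_monoid_def quotient_monoid_def presentation_class_def
  by (auto simp: free_carrier quotient_def)

lemma cl_append:
  "u \<in> words X \<Longrightarrow> v \<in> words X \<Longrightarrow> cl (u @ v) = cl u \<otimes>\<^bsub>M\<^esub> cl v"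
  using quotient_monoid_mult[OF free_monoid K_congruence, of "V `` {u}" "V `` {v}"]
  by (simp add: presented_inverse_monoid_def presentation_class_def free_carrier free_mult)

lemma one_M: "\<one>\<^bsub>M\<^esub> = cl []"
  by (simp add: presented_inverse_monoid_def presentation_class_def quotient_monoid_def
      free_inverse_monoid_def word_monoid_def)

lemma cl_Vagner: "(u, v) \<in> V \<Longrightarrow> cl u = cl v"
  using equiv_class_eq[OF V_equiv, of u v] by (simp add: presentation_class_def)

lemma cl_Vagner_relations: "(u, v) \<in> Vagner_relations X \<Longrightarrow> cl u = cl v"
  using congruence_generated_by_superset[of "Vagner_relations X" "word_monoid X"]
  by (auto simp: Vagner_congruence_def intro!: cl_Vagner[unfolded Vagner_congruence_def])

lemma cl_cancel: "u \<in> words X \<Longrightarrow> cl (u @ word_inverse u @ u) = cl u"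
  by (rule cl_Vagner_relations) (auto simp: Vagner_relations_def)

lemma cl_commute:
  "u \<in> words X \<Longrightarrow> v \<in> words X \<Longrightarrow>
    cl (u @ word_inverse u @ v @ word_inverse v) = cl (v @ word_inverse v @ u @ word_inverse u)"
  by (rule cl_Vagner_relations) (auto simp: Vagner_relations_def)

lemma cl_relation:
  assumes "(u, v) \<in> R"
  shows "cl u = cl v"
  unfolding presentation_class_def
  by (rule equiv_class_eq[OF K_equiv])
     (use assms congruence_generated_by_superset[of FR] in blast)

text \<open>
  The universal property of the presentation: a congruence on words that respects the Vagner
  relations and \<open>R\<close> contains equality in \<open>M\<close>. The carrier is a quotient of a quotient, so the
  congruence is pushed down to one on the free inverse monoid.
\<close>

lemma cl_eq_imp:
  assumes C: "monoid_congruence (word_monoid X) C"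
    and rel: "Vagner_relations X \<subseteq> C" "R \<subseteq> C"
    and eq: "cl u = cl v" and u: "u \<in> words X" and v: "v \<in> words X"
  shows "(u, v) \<in> C"
proof -
  have VC: "V \<subseteq> C"
    unfolding Vagner_congruence_def by (rule congruence_generated_by_least[OF C rel(1)])
  have Ceq: "equiv (words X) C"
    and Cl: "\<And>a b c. (a, b) \<in> C \<Longrightarrow> c \<in> words X \<Longrightarrow> (c @ a, c @ b) \<in> C"
    and Cr: "\<And>a b c. (a, b) \<in> C \<Longrightarrow> c \<in> words X \<Longrightarrow> (a @ c, b @ c) \<in> C"
    using C by (auto simp: monoid_congruence_def word_monoid_def)
  have Csub: "C \<subseteq> words X \<times> words X" using Ceq by (auto simp: equiv_def)
  have transC: "(a, c) \<in> C" if "(a, b) \<in> C" "(b, c) \<in> C" for a b c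
    using Ceq that unfolding equiv_def by (blast dest: transD)
  have symC: "(b, a) \<in> C" if "(a, b) \<in> C" for a b
    using Ceq that unfolding equiv_def by (blast dest: symD)
  define q where "q = (\<lambda>w. V `` {w})"
  have q_carrier: "carrier (free_inverse_monoid X) = q ` words X"
    by (simp add: q_def free_carrier)
  have q_mult: "q a \<otimes>\<^bsub>free_inverse_monoid X\<^esub> q b = q (a @ b)"
    if "a \<in> words X" "b \<in> words X" for a b
    using that by (simp add: q_def free_mult)
  have q_eq: "(a, b) \<in> C" if "q a = q b" "(b, c) \<in> C \<or> (c, b) \<in> C \<or> b \<in> words X" for a b c
    using eq_equiv_class[OF _ V_equiv, of a b] that Csub VC by (auto simp: q_def)
  define D where "D = {(q a, q b) | a b. (a, b) \<in> C}"
  have D_cases: "\<exists>a b. x = q a \<and> y = q b \<and> (a, b) \<in> C" if "(x, y) \<in> D" for x y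
    using that by (simp add: D_def)
  have D_intro: "(q a, q b) \<in> D" if "(a, b) \<in> C" for a b
    using that by (auto simp: D_def)
  have "monoid_congruence (free_inverse_monoid X) D"
    unfolding monoid_congruence_def
  proof (intro conjI allI impI)
    have "refl_on (carrier (free_inverse_monoid X)) D"
      using Ceq D_intro by (auto simp: q_carrier equiv_def refl_on_def)
    moreover have "sym D"
      by (rule symI) (metis D_cases D_intro symC)
    moreover have "trans D"
    proof (rule transI)
      fix x y z assume "(x, y) \<in> D" "(y, z) \<in> D"
      then obtain a b c d where *: "x = q a" "y = q b" "(a, b) \<in> C"
        "y = q c" "z = q d" "(c, d) \<in> C" by (metis D_cases)
      have "(b, c) \<in> C" using q_eq[of b c d] * by simp
      then have "(a, d) \<in> C" using *(3,6) by (metis transC)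
      then show "(x, z) \<in> D" using * D_intro by simp
    qed
    moreover have "D \<subseteq> carrier (free_inverse_monoid X) \<times> carrier (free_inverse_monoid X)"
      using Csub unfolding q_carrier D_def by blast
    ultimately show "equiv (carrier (free_inverse_monoid X)) D" by (auto intro!: equivI)
  next
    fix x y z assume "(x, y) \<in> D \<and> z \<in> carrier (free_inverse_monoid X)"
    then obtain a b c where *: "x = q a" "y = q b" "(a, b) \<in> C" "z = q c" "c \<in> words X"
      unfolding q_carrier using D_cases by blast
    have ab: "a \<in> words X" "b \<in> words X" using * Csub by auto
    show "(x \<otimes>\<^bsub>free_inverse_monoid X\<^esub> z, y \<otimes>\<^bsub>free_inverse_monoid X\<^esub> z) \<in> D"
      using * ab Cr[OF *(3,5)] by (simp add: q_mult D_intro)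
    show "(z \<otimes>\<^bsub>free_inverse_monoid X\<^esub> x, z \<otimes>\<^bsub>free_inverse_monoid X\<^esub> y) \<in> D"
      using * ab Cl[OF *(3,5)] by (simp add: q_mult D_intro)
  qed
  moreover have "{(q a, q b) | a b. (a, b) \<in> R} \<subseteq> D"
    using rel(2) unfolding D_def by blast
  then have "FR \<subseteq> D" by (simp add: q_def)
  ultimately have "K \<subseteq> D" by (rule congruence_generated_by_least)
  moreover have "(q u, q v) \<in> K"
    using eq v unfolding presentation_class_def q_def
    by (intro eq_equiv_class[OF _ K_equiv]) (auto simp: free_carrier)
  ultimately have "(q u, q v) \<in> D" by (rule subsetD)
  from D_cases[OF this] obtain a b where ab: "q u = q a" "q v = q b" "(a, b) \<in> C"
    by (elim exE conjE)
  have "(u, a) \<in> C" "(v, b) \<in> C" using q_eq[of u a b] q_eq[of v b a] ab by simp_all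
  then show ?thesis using ab(3) by (metis symC transC)
qed

lemma inverse_monoid_M: "inverse_monoid M"
proof (rule inverse_monoidI_commuting[OF M_monoid])
  let ?E = "(\<lambda>u. cl (u @ word_inverse u)) ` words X"
  show "\<exists>y\<in>carrier M. x \<otimes>\<^bsub>M\<^esub> y \<otimes>\<^bsub>M\<^esub> x = x \<and> y \<otimes>\<^bsub>M\<^esub> x \<otimes>\<^bsub>M\<^esub> y = y \<and> x \<otimes>\<^bsub>M\<^esub> y \<in> ?E \<and> y \<otimes>\<^bsub>M\<^esub> x \<in> ?E"
    if x: "x \<in> carrier M" for x
  proof -
    obtain u where u: "u \<in> words X" "x = cl u" using x by (auto simp: M_carrier)
    have "cl (word_inverse u @ word_inverse (word_inverse u)) \<in> ?E"
      using u(1) by (intro imageI) simp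
    then show ?thesis
      using u cl_cancel[OF u(1)] cl_cancel[of "word_inverse u"]
      by (intro bexI[of _ "cl (word_inverse u)"]) (auto simp: cl_append[symmetric] M_carrier)
  qed
  show "e \<otimes>\<^bsub>M\<^esub> f = f \<otimes>\<^bsub>M\<^esub> e" if "e \<in> ?E" "f \<in> ?E" for e f
    using that by (auto simp: cl_append[symmetric] cl_commute)
qed

sublocale inverse_monoid M
  by (rule inverse_monoid_M)

lemma minv_cl: "u \<in> words X \<Longrightarrow> minv M (cl u) = cl (word_inverse u)"
  using cl_cancel[of u] cl_cancel[of "word_inverse u"]
  by (intro minv_unique) (auto simp: cl_append[symmetric] M_carrier)

lemma cl_context:
  assumes "cl u = cl v" "u \<in> words X" "v \<in> words X" "x \<in> words X" "y \<in> words X"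
  shows "cl (x @ u @ y) = cl (x @ v @ y)"
  using assms by (simp add: cl_append)

lemma cl_word_inverse_cong:
  "cl u = cl v \<Longrightarrow> u \<in> words X \<Longrightarrow> v \<in> words X \<Longrightarrow> cl (word_inverse u) = cl (word_inverse v)"
  by (metis minv_cl)

text \<open>
  \<open>u v\<^sup>-\<^sup>1 = 1\<close> gives \<open>u\<^sup>-\<^sup>1 = u\<^sup>-\<^sup>1 u v\<^sup>-\<^sup>1\<close>, that is, \<open>u\<^sup>-\<^sup>1\<close> lies below \<open>v\<^sup>-\<^sup>1\<close> in the natural partial
  order. By symmetry the two coincide. This is how special relations yield equations between words.
\<close>

lemma cl_eqI:
  assumes u: "u \<in> words X" and v: "v \<in> words X"
    and uv: "cl (u @ word_inverse v) = cl []" and vu: "cl (v @ word_inverse u) = cl []"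
  shows "cl u = cl v"
proof -
  have nil: "[] \<in> words X" by (simp add: words_def)
  let ?u = "word_inverse u" and ?v = "word_inverse v"
  have "cl ?u = cl (?u @ u @ ?v)"
    using cl_context[OF uv, of ?u "[]"] u v nil by simp
  also have "\<dots> = cl ((?u @ u) @ ?v @ v @ ?v)"
    using cl_context[OF cl_cancel[of ?v], of "?u @ u" "[]"] u v nil by simp
  also have "\<dots> = cl ((?v @ v @ ?u @ u) @ ?v)"
    using cl_context[OF cl_commute[of ?u ?v], of "[]" ?v] u v nil by simp
  also have "\<dots> = cl (?v @ v @ ?u)"
    using cl_context[OF uv, of "?v @ v @ ?u" "[]"] u v nil by simp
  also have "\<dots> = cl ?v"
    using cl_context[OF vu, of ?v "[]"] u v nil by simp
  finally show ?thesis
    using cl_word_inverse_cong[of ?u ?v] u v by simp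
qed

lemma Nil_in_words: "[] \<in> words X"
  by (simp add: words_def)

lemma cl_idempotent: "u \<in> words X \<Longrightarrow> cl (word_inverse u @ u) \<in> idempotents M"
  using cl_context[OF cl_cancel[of u], of "word_inverse u" "[]"]
  by (simp add: idempotents_def M_carrier cl_append[symmetric] Nil_in_words)

end

section \<open>Actions by partial injections\<close>

fun run :: "('c \<Rightarrow> 'v \<Rightarrow> 'v option) \<Rightarrow> 'c list \<Rightarrow> 'v \<Rightarrow> 'v option" where
  "run act [] v = Some v"
| "run act (c # w) v = Option.bind (act c v) (run act w)"

lemma run_append: "run act (u @ w) v = Option.bind (run act u v) (run act w)"
  by (induction u arbitrary: v) (auto split: bind_splits)

text \<open>
  An action of words in which inverse letters act as inverse partial injections of \<open>S\<close>. Partial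
  injections form an inverse monoid, so the Vagner relations hold automatically and only the
  defining relations have to be checked for \<open>M\<close> to act (\<open>run_eq_if_cl_eq\<close>). The set \<open>S\<close> keeps group
  elements inside the carrier.
\<close>

locale partial_injection_action =
  fixes act :: "'x \<times> bool \<Rightarrow> 'v \<Rightarrow> 'v option" and S :: "'v set"
  assumes act_closed: "v \<in> S \<Longrightarrow> act c v = Some v' \<Longrightarrow> v' \<in> S"
    and act_inverse: "v \<in> S \<Longrightarrow> v' \<in> S \<Longrightarrow> act (x, True) v = Some v' \<longleftrightarrow> act (x, False) v' = Some v"
begin

lemma run_closed: "run act w v = Some v' \<Longrightarrow> v \<in> S \<Longrightarrow> v' \<in> S"
  by (induction w arbitrary: v) (auto simp: bind_eq_Some_conv dest: act_closed)

lemma run_word_inverse_Some: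
  "run act w v = Some v' \<Longrightarrow> v \<in> S \<Longrightarrow> run act (word_inverse w) v' = Some v"
proof (induction w arbitrary: v)
  case (Cons c w)
  obtain x b where c: "c = (x, b)" by (cases c)
  from Cons.prems c obtain u where u: "act (x, b) v = Some u" "run act w u = Some v'"
    by (auto simp: bind_eq_Some_conv)
  have uS: "u \<in> S" using u act_closed Cons.prems by blast
  then have "act (x, \<not> b) u = Some v" using act_inverse u Cons.prems by (cases b) auto
  then show ?case using Cons.IH[OF u(2) uS] by (simp add: c run_append)
qed simp

lemma run_idempotent:
  "v \<in> S \<Longrightarrow> run act (w @ word_inverse w) v = (if run act w v = None then None else Some v)"
  by (auto simp: run_append run_word_inverse_Some)

lemma run_eq_if_cl_eq:
  assumes pres: "inverse_presentation X R"
    and rel: "\<And>r s v. (r, s) \<in> R \<Longrightarrow> v \<in> S \<Longrightarrow> run act r v = run act s v"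
    and eq: "presentation_class X R u = presentation_class X R w"
      "u \<in> words X" "w \<in> words X" "v \<in> S"
  shows "run act u v = run act w v"
proof -
  interpret inverse_presentation X R by fact
  let ?C = "{(u, w). u \<in> words X \<and> w \<in> words X \<and> (\<forall>v\<in>S. run act u v = run act w v)}"
  have "(u, w) \<in> ?C"
  proof (rule cl_eq_imp[OF _ _ _ eq(1-3)])
    have "run act (a @ c) v = run act (b @ c) v \<and> run act (c @ a) v = run act (c @ b) v"
      if "(a, b) \<in> ?C" "v \<in> S" for a b c v
      using that run_closed by (auto simp: run_append split: bind_splits)
    moreover have "equiv (words X) ?C"
      by (rule equivI) (auto simp: refl_on_def sym_def trans_def)
    ultimately show "monoid_congruence (word_monoid X) ?C"
      by (auto simp: monoid_congruence_def word_monoid_def)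
    have "run act (u @ word_inverse u @ u) v = run act u v" if "v \<in> S" for u v
      using that run_idempotent[of v u] run_append[of act "u @ word_inverse u" u v]
      by (auto split: if_splits)
    moreover have "run act (u @ word_inverse u @ w @ word_inverse w) v =
        run act (w @ word_inverse w @ u @ word_inverse u) v" if "v \<in> S" for u v w
      using that run_idempotent[of v] run_append[of act "u @ word_inverse u" "w @ word_inverse w" v]
        run_append[of act "w @ word_inverse w" "u @ word_inverse u" v]
      by (auto split: if_splits)
    ultimately show "Vagner_relations X \<subseteq> ?C"
      by (auto simp: Vagner_relations_def)
    show "R \<subseteq> ?C" using relations_over rel by blast
  qed
  then show ?thesis using eq by blast
qed

end

section \<open>The presentation\<close>

lemma words_UNIV [simp]: "words UNIV = UNIV"
  by (simp add: words_def)

text \<open>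
  Vertices of the Schutzenberger graphs. \<open>Node g [h\<^sub>1, \<dots>, h\<^sub>k]\<close> is the vertex \<open>g\<close> of the copy of the
  group above the vertex \<open>h\<^sub>1\<close>, which lies in the copy above \<open>h\<^sub>2\<close>, and so on; \<open>h\<^sub>k\<close>,
  or \<open>g\<close> if the list is empty, is in the base.
  \<open>Root g\<close> is the source of a \<open>t\<close>-edge into the base vertex \<open>g\<close>.
\<close>

datatype 'g vertex = Root 'g | Node 'g "'g list"

locale enumerated_group = group G for G :: "('g, 'h) monoid_scheme" (structure) +
  fixes elems :: "'g list"
  assumes set_elems: "set elems = carrier G"
begin

text \<open>
  Letter \<open>i\<close> names the \<open>i\<close>-th group element, and all letters beyond the list name the identity,
  so that every word over the natural numbers has a value.
\<close>

definition letter_value :: "nat \<times> bool \<Rightarrow> 'g" where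
  "letter_value c =
     (let g = if fst c < length elems then elems ! fst c else \<one> in if snd c then g else inv g)"

primrec evaluate :: "nat word \<Rightarrow> 'g" where
  "evaluate [] = \<one>"
| "evaluate (c # w) = letter_value c \<otimes> evaluate w"

text \<open>The letter \<open>0\<close> is reserved for \<open>t\<close>, so the naming letters are moved up by one.\<close>

definition shift :: "nat word \<Rightarrow> nat word" where
  "shift w = map (apfst Suc) w"

abbreviation t :: "nat word" where "t \<equiv> [(0, True)]"
abbreviation t_inv :: "nat word" where "t_inv \<equiv> [(0, False)]"

definition relators :: "(nat word \<times> nat word) set" where
  "relators = {(t @ shift w @ t_inv, []) | w. evaluate w = \<one>}"

definition gen :: "'g \<Rightarrow> nat word" where
  "gen g = [(SOME i. i < length elems \<and> elems ! i = g, True)]"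

abbreviation a :: "'g \<Rightarrow> nat word" where "a g \<equiv> shift (gen g)"

sublocale P: inverse_presentation UNIV relators
  by unfold_locales simp

lemma letter_value_closed [simp]: "letter_value c \<in> carrier G"
  using set_elems nth_mem by (fastforce simp: letter_value_def Let_def)

lemma letter_value_inverse: "letter_value (x, \<not> b) = inv letter_value (x, b)"
proof -
  have "(if x < length elems then elems ! x else \<one>) \<in> carrier G"
    using set_elems nth_mem by fastforce
  then show ?thesis by (auto simp: letter_value_def Let_def split: if_splits)
qed

lemma evaluate_closed [simp]: "evaluate w \<in> carrier G"
  by (induction w) auto

lemma evaluate_append [simp]: "evaluate (u @ w) = evaluate u \<otimes> evaluate w"
  by (induction u) (auto simp: m_assoc)

lemma evaluate_word_inverse [simp]: "evaluate (word_inverse w) = inv evaluate w"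
proof (induction w)
  case (Cons c w)
  then show ?case
    by (cases c) (simp add: letter_value_inverse inv_mult_group)
qed simp

lemma evaluate_gen [simp]:
  assumes "g \<in> carrier G"
  shows "evaluate (gen g) = g"
proof -
  have "\<exists>i. i < length elems \<and> elems ! i = g"
    using assms set_elems by (metis in_set_conv_nth)
  from someI_ex[OF this] show ?thesis
    using assms by (simp add: gen_def letter_value_def)
qed

lemma shift_append [simp]: "shift (u @ w) = shift u @ shift w"
  and shift_Nil [simp]: "shift [] = []"
  and shift_Cons: "shift ((i, b) # w) = (Suc i, b) # shift w"
  by (simp_all add: shift_def)

lemma word_inverse_shift [simp]: "word_inverse (shift w) = shift (word_inverse w)"
  by (simp add: word_inverse_def shift_def rev_map case_prod_unfold)

text \<open>
  Behind a \<open>t\<close>, naming words multiply as in the group: \<open>u v\<^sup>-\<^sup>1\<close> and \<open>v u\<^sup>-\<^sup>1\<close> both have value \<open>1\<close>, so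
  \<open>(t u) (t v)\<^sup>-\<^sup>1\<close> and \<open>(t v) (t u)\<^sup>-\<^sup>1\<close> are relators.
\<close>

lemma t_absorbs:
  assumes "evaluate u = evaluate w"
  shows "P.cl (t @ shift u) = P.cl (t @ shift w)"
proof (rule P.cl_eqI)
  have "P.cl (t @ shift (u @ word_inverse w) @ t_inv) = P.cl []"
    using assms by (intro P.cl_relation) (auto simp: relators_def simp del: shift_append)
  then show "P.cl ((t @ shift u) @ word_inverse (t @ shift w)) = P.cl []" by simp
  have "P.cl (t @ shift (w @ word_inverse u) @ t_inv) = P.cl []"
    using assms by (intro P.cl_relation) (auto simp: relators_def simp del: shift_append)
  then show "P.cl ((t @ shift w) @ word_inverse (t @ shift u)) = P.cl []" by simp
qed simp_all

section \<open>Two Schutzenberger graphs\<close>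

text \<open>
  The set \<open>A\<close> consists of the base vertices with an incoming \<open>t\<close>-edge. For \<open>A = {\<one>}\<close> this is the
  graph of the idempotent \<open>1\<close>, with base point \<open>Root \<one>\<close>; for \<open>A = G\<close> it is the graph of \<open>e\<close>, with
  base point \<open>Node \<one> []\<close>. Above the base, \<open>t\<close>-edges end in the identity of each copy.
\<close>

fun vertex_act :: "'g set \<Rightarrow> nat \<times> bool \<Rightarrow> 'g vertex \<Rightarrow> 'g vertex option" where
  "vertex_act A (0, True) (Root g) = Some (Node g [])"
| "vertex_act A (0, True) (Node g l) = Some (Node \<one> (g # l))"
| "vertex_act A (0, False) (Root g) = None"
| "vertex_act A (0, False) (Node g []) = (if g \<in> A then Some (Root g) else None)"
| "vertex_act A (0, False) (Node g (h # l)) = (if g = \<one> then Some (Node h l) else None)"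
| "vertex_act A (Suc i, b) (Root g) = None"
| "vertex_act A (Suc i, b) (Node g l) = Some (Node (g \<otimes> letter_value (i, b)) l)"

definition vertices :: "'g set \<Rightarrow> 'g vertex set" where
  "vertices A = Root ` A \<union> {Node g l | g l. g \<in> carrier G \<and> set l \<subseteq> carrier G}"

lemma vertices_simps [simp]:
  "Root g \<in> vertices A \<longleftrightarrow> g \<in> A"
  "Node g l \<in> vertices A \<longleftrightarrow> g \<in> carrier G \<and> set l \<subseteq> carrier G"
  by (auto simp: vertices_def)

lemma vertex_action:
  assumes "A \<subseteq> carrier G"
  shows "partial_injection_action (vertex_act A) (vertices A)"
proof
  show "v' \<in> vertices A" if "v \<in> vertices A" "vertex_act A c v = Some v'" for v c v'
    using that assms by (cases "(A, c, v)" rule: vertex_act.cases) (auto split: if_splits)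
  show "vertex_act A (x, True) v = Some v' \<longleftrightarrow> vertex_act A (x, False) v' = Some v"
    if v: "v \<in> vertices A" and v': "v' \<in> vertices A" for v v' x
  proof (cases x)
    case 0
    show ?thesis
    proof (cases "(A, (0 :: nat, False), v')" rule: vertex_act.cases)
    qed (use v v' 0 in \<open>(cases v; auto split: if_splits)+\<close>)
  next
    case (Suc i)
    have "letter_value (i, False) = inv letter_value (i, True)"
      using letter_value_inverse[of i True] by simp
    then show ?thesis
      using v v' Suc by (cases v; cases v') (auto simp: m_assoc)
  qed
qed

lemma run_shift:
  "g \<in> carrier G \<Longrightarrow> run (vertex_act A) (shift w) (Node g l) = Some (Node (g \<otimes> evaluate w) l)"
proof (induction w arbitrary: g)
  case (Cons c w)
  then show ?case by (cases c) (simp add: shift_Cons m_assoc)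
qed simp

lemma vertex_run_eq:
  assumes "A \<subseteq> carrier G" "P.cl u = P.cl w" "v \<in> vertices A"
  shows "run (vertex_act A) u v = run (vertex_act A) w v"
proof (rule partial_injection_action.run_eq_if_cl_eq[OF vertex_action[OF assms(1)]
      P.inverse_presentation_axioms _ assms(2) _ _ assms(3)])
  show "run (vertex_act A) r v = run (vertex_act A) s v"
    if "(r, s) \<in> relators" "v \<in> vertices A" for r s v
    using that assms(1) by (cases v) (auto simp: relators_def run_append run_shift)
qed simp_all

fun spell :: "('g \<Rightarrow> nat word) \<Rightarrow> ('g \<Rightarrow> nat word) \<Rightarrow> 'g vertex \<Rightarrow> nat word" where
  "spell r b (Root g) = r g"
| "spell r b (Node g []) = b g"
| "spell r b (Node g (h # l)) = spell r b (Node h l) @ t @ a g"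

lemma cl_context: "P.cl u = P.cl w \<Longrightarrow> P.cl (x @ u @ y) = P.cl (x @ w @ y)"
  by (rule P.cl_context) simp_all

text \<open>
  If \<open>spell\<close> assigns to each vertex a word leading there, then following an edge never leaves the
  set of spellings, up to equality in \<open>M\<close>. Above the base this is \<open>t_absorbs\<close>; the hypotheses ask
  for it at the roots and in the base, where the two graphs differ.
\<close>

lemma spell_run:
  assumes A: "A \<subseteq> carrier G"
    and down: "\<And>g. g \<in> A \<Longrightarrow> P.cl (r g @ t) = P.cl (b g)"
    and up: "\<And>g. g \<in> A \<Longrightarrow> P.cl (b g @ t_inv) = P.cl (r g)"
    and side: "\<And>g c. g \<in> carrier G \<Longrightarrow> P.cl (b g @ shift [c]) = P.cl (b (g \<otimes> letter_value c))"
    and v: "v \<in> vertices A" and run: "run (vertex_act A) w v = Some v'"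
  shows "P.cl (spell r b v @ w) = P.cl (spell r b v')"
proof -
  \<comment> \<open>Only cases 2, 5 and 7, the edges starting in a node that involve an upper copy or a
    naming letter, need more than the hypotheses.\<close>
  have step: "P.cl (spell r b v @ [c]) = P.cl (spell r b v')"
    if "vertex_act A c v = Some v'" "v \<in> vertices A" for c v v'
  proof (cases "(A, c, v)" rule: vertex_act.cases)
    case (2 _ g l)
    have "P.cl (spell r b v @ t @ shift []) = P.cl (spell r b v @ t @ a \<one>)"
      using cl_context[OF t_absorbs[of "[]" "gen \<one>"], of "spell r b v" "[]"] by simp
    moreover have "v = Node g l" "c = (0, True)" "v' = Node \<one> (g # l)" using that 2 by auto
    ultimately show ?thesis by simp
  next
    case (5 _ g h l)
    have "P.cl (t @ a \<one> @ t_inv) = P.cl []"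
      by (rule P.cl_relation) (auto simp: relators_def)
    from cl_context[OF this, of "spell r b (Node h l)" "[]"]
    show ?thesis using that 5 by (auto split: if_splits)
  next
    case (7 _ i b' g l)
    show ?thesis
    proof (cases l)
      case Nil
      then have "v = Node g []" "c = (Suc i, b')" "v' = Node (g \<otimes> letter_value (i, b')) []"
        "g \<in> carrier G"
        using that 7 by auto
      then show ?thesis using side[of g "(i, b')"] by (simp add: shift_Cons)
    next
      case (Cons h l')
      have "P.cl (t @ shift (gen g @ [(i, b')])) = P.cl (t @ a (g \<otimes> letter_value (i, b')))"
        using that 7 by (intro t_absorbs) simp
      from cl_context[OF this, of "spell r b (Node h l')" "[]"]
      moreover have "v = Node g (h # l')" "c = (Suc i, b')"
        "v' = Node (g \<otimes> letter_value (i, b')) (h # l')"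
        using that 7 Cons by auto
      ultimately show ?thesis by (simp add: shift_Cons)
    qed
  qed (use that down up in \<open>auto split: if_splits\<close>)
  interpret partial_injection_action "vertex_act A" "vertices A" by (rule vertex_action[OF A])
  show ?thesis
    using v run
  proof (induction w arbitrary: v)
    case (Cons c w)
    then obtain u where u: "vertex_act A c v = Some u" "run (vertex_act A) w u = Some v'"
      by (auto simp: bind_eq_Some_conv)
    have "P.cl (spell r b v @ c # w) = P.cl (spell r b u @ w)"
      using cl_context[OF step[OF u(1) Cons.prems(1)], of "[]" w] by simp
    also have "\<dots> = P.cl (spell r b v')"
      using Cons.IH[OF act_closed[OF Cons.prems(1) u(1)] u(2)] .
    finally show ?case .
  qed simp
qed

section \<open>The right units\<close>

primrec climb :: "'g list \<Rightarrow> nat word" where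
  "climb [] = []"
| "climb (g # l) = climb l @ t @ a g"

text \<open>
  A right unit \<open>w\<close> satisfies \<open>w w\<^sup>-\<^sup>1 = 1\<close>, and \<open>1\<close> fixes the base point \<open>Root \<one>\<close>; hence \<open>w\<close> is a path
  starting there, and it equals the spelling of its end point.
\<close>

lemma R1_class_climb:
  assumes "m \<in> R1_class P.M"
  shows "\<exists>l. set l \<subseteq> carrier G \<and> m = P.cl (climb l)"
proof -
  obtain w where w: "m = P.cl w" and "P.cl w \<otimes>\<^bsub>P.M\<^esub> minv P.M (P.cl w) = \<one>\<^bsub>P.M\<^esub>"
    using assms unfolding P.R1_class_eq P.M_carrier by auto
  then have ww: "P.cl (w @ word_inverse w) = P.cl []"
    by (simp add: P.minv_cl P.cl_append P.one_M)
  let ?A = "{\<one>}"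
  have A: "?A \<subseteq> carrier G" by simp
  interpret partial_injection_action "vertex_act ?A" "vertices ?A" by (rule vertex_action[OF A])
  have "run (vertex_act ?A) (w @ word_inverse w) (Root \<one>) = Some (Root \<one>)"
    using vertex_run_eq[OF A ww, of "Root \<one>"] by simp
  then obtain v where v: "run (vertex_act ?A) w (Root \<one>) = Some v"
    by (auto simp: run_append bind_eq_Some_conv)
  let ?r = "\<lambda>_. []" and ?b = "\<lambda>g. t @ a g"
  have "P.cl (spell ?r ?b (Root \<one>) @ w) = P.cl (spell ?r ?b v)"
  proof (rule spell_run[OF A _ _ _ _ v])
    show "P.cl (?r g @ t) = P.cl (?b g)" if "g \<in> ?A" for g
      using that t_absorbs[of "[]" "gen \<one>"] by simp
    show "P.cl (?b g @ t_inv) = P.cl (?r g)" if "g \<in> ?A" for g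
      using that by (intro P.cl_relation) (auto simp: relators_def)
    show "P.cl (?b g @ shift [c]) = P.cl (?b (g \<otimes> letter_value c))" if "g \<in> carrier G" for g c
      using that t_absorbs[of "gen g @ [c]" "gen (g \<otimes> letter_value c)"] by simp
  qed simp
  then have w': "m = P.cl (spell ?r ?b v)" using w by simp
  have sp: "spell ?r ?b (Node g l) = climb (g # l)" for g l
    by (induction l arbitrary: g) auto
  have "v \<in> vertices ?A" using run_closed[OF v] by simp
  then show ?thesis
  proof (cases v)
    case (Root g)
    then show ?thesis using w' by (intro exI[of _ "[]"]) simp
  next
    case (Node g l)
    then show ?thesis using w' sp \<open>v \<in> vertices ?A\<close> by (intro exI[of _ "g # l"]) simp
  qed
qed

section \<open>The lamplighter group\<close>

text \<open>
  The right regular representation of the lamplighter group \<open>G \<wr> \<int>\<close>, on configurations of the lamps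
  together with the position of the lamplighter: \<open>t\<close> moves, and a naming letter turns the lamp at
  the current position. Since this action is total, idempotents act as the identity
  (\<open>lamp_run_idempotent\<close>), and so the action factors through the maximal group image.
\<close>

fun lamp_act :: "nat \<times> bool \<Rightarrow> (int \<Rightarrow> 'g) \<times> int \<Rightarrow> ((int \<Rightarrow> 'g) \<times> int) option" where
  "lamp_act (0, b) (f, n) = Some (f, if b then n + 1 else n - 1)"
| "lamp_act (Suc i, b) (f, n) = Some (f(n := f n \<otimes> letter_value (i, b)), n)"

definition lamp_states :: "((int \<Rightarrow> 'g) \<times> int) set" where
  "lamp_states = {(f, n). range f \<subseteq> carrier G}"

lemma lamp_action: "partial_injection_action lamp_act lamp_states"
proof
  show "v' \<in> lamp_states" if "v \<in> lamp_states" "lamp_act c v = Some v'" for v c v'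
    using that by (cases "(c, v)" rule: lamp_act.cases) (auto simp: lamp_states_def image_subset_iff)
  show "lamp_act (x, True) v = Some v' \<longleftrightarrow> lamp_act (x, False) v' = Some v"
    if "v \<in> lamp_states" "v' \<in> lamp_states" for v v' x
  proof (cases x)
    case 0
    then show ?thesis by (cases v; cases v') auto
  next
    case (Suc i)
    have "letter_value (i, False) = inv letter_value (i, True)"
      using letter_value_inverse[of i True] by simp
    moreover obtain f n f' n' where v: "v = (f, n)" "v' = (f', n')" by (cases v; cases v')
    moreover have "f n \<otimes> letter_value (i, True) = f' n \<longleftrightarrow> f' n \<otimes> inv letter_value (i, True) = f n"
    proof -
      have "f n \<in> carrier G" "f' n \<in> carrier G" using that v by (auto simp: lamp_states_def)
      then show ?thesis using inv_solve_right' by auto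
    qed
    ultimately show ?thesis
      using Suc by (auto simp: fun_eq_iff)
  qed
qed

lemma lamp_run_shift:
  "range f \<subseteq> carrier G \<Longrightarrow> run lamp_act (shift w) (f, n) = Some (f(n := f n \<otimes> evaluate w), n)"
proof (induction w arbitrary: f)
  case Nil
  then show ?case using r_one[of "f n"] by (auto simp: image_subset_iff)
next
  case (Cons c w)
  have *: "f k \<in> carrier G" for k using Cons.prems by auto
  define h where "h = f(n := f n \<otimes> letter_value c)"
  have "range h \<subseteq> carrier G"
    using * by (auto simp: h_def)
  then have "run lamp_act (shift w) (h, n) = Some (h(n := h n \<otimes> evaluate w), n)"
    by (rule Cons.IH)
  moreover have "h(n := h n \<otimes> evaluate w) = f(n := f n \<otimes> evaluate (c # w))"
    using * by (simp add: h_def m_assoc)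
  moreover have "run lamp_act (shift (c # w)) (f, n) = run lamp_act (shift w) (h, n)"
    by (cases c) (simp add: shift_Cons h_def)
  ultimately show ?case by (simp add: fun_upd_def)
qed

lemma lamp_run_eq:
  assumes "P.cl u = P.cl w" "v \<in> lamp_states"
  shows "run lamp_act u v = run lamp_act w v"
proof (rule partial_injection_action.run_eq_if_cl_eq[OF lamp_action
      P.inverse_presentation_axioms _ assms(1) _ _ assms(2)])
  show "run lamp_act r v = run lamp_act s v"
    if rs: "(r, s) \<in> relators" and v: "v \<in> lamp_states" for r s v
  proof -
    obtain f n where fn: "v = (f, n)" "range f \<subseteq> carrier G"
      using v by (auto simp: lamp_states_def)
    then have "f k \<in> carrier G" for k by auto
    then show ?thesis
      using rs fn by (auto simp: relators_def run_append lamp_run_shift)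
  qed
qed simp_all

lemma lamp_run_total: "\<exists>v'. run lamp_act w v = Some v'"
proof (induction w arbitrary: v)
  case (Cons c w)
  obtain u where "lamp_act c v = Some u" by (cases "(c, v)" rule: lamp_act.cases) auto
  then show ?case using Cons.IH[of u] by auto
qed simp

lemma lamp_run_idempotent:
  assumes "P.cl w \<in> idempotents P.M" "v \<in> lamp_states"
  shows "run lamp_act w v = Some v"
proof -
  interpret partial_injection_action lamp_act lamp_states by (rule lamp_action)
  obtain v' where v': "run lamp_act w v = Some v'" using lamp_run_total by blast
  have "P.cl (w @ w) = P.cl w" using assms(1) by (simp add: idempotents_def P.cl_append)
  then have "run lamp_act (w @ w) v = run lamp_act w v" by (rule lamp_run_eq[OF _ assms(2)])
  then have "run lamp_act w v' = Some v'" using v' by (simp add: run_append)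
  then have "run lamp_act (word_inverse w) v' = Some v'"
    using run_word_inverse_Some run_closed[OF v' assms(2)] by blast
  then show ?thesis using v' run_word_inverse_Some[OF v' assms(2)] by simp
qed

abbreviation dark :: "(int \<Rightarrow> 'g) \<times> int" where
  "dark \<equiv> (\<lambda>_. \<one>, 0)"

lemma dark_state: "dark \<in> lamp_states"
  by (auto simp: lamp_states_def)

primrec lamps :: "'g list \<Rightarrow> int \<Rightarrow> 'g" where
  "lamps [] = (\<lambda>_. \<one>)"
| "lamps (g # l) = (lamps l)(1 + int (length l) := g)"

lemma lamps_beyond: "int (length l) < i \<Longrightarrow> lamps l i = \<one>"
  by (induction l) auto

lemma lamps_closed: "set l \<subseteq> carrier G \<Longrightarrow> range (lamps l) \<subseteq> carrier G"
  by (induction l) (auto simp: image_subset_iff)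

lemma lamp_run_climb:
  "set l \<subseteq> carrier G \<Longrightarrow> run lamp_act (climb l) dark = Some (lamps l, int (length l))"
  by (induction l) (simp_all add: run_append lamp_run_shift lamps_closed lamps_beyond add.commute)

lemma lamps_inject: "length l = length l' \<Longrightarrow> lamps l = lamps l' \<Longrightarrow> l = l'"
proof (induction l l' rule: list_induct2)
  case (Cons g l g' l')
  have "g = g'" using fun_cong[OF Cons.prems, of "1 + int (length l)"] Cons.hyps by simp
  moreover have "lamps l i = lamps l' i" for i
    using fun_cong[OF Cons.prems, of i] Cons.hyps
    by (cases "i = 1 + int (length l)") (auto simp: lamps_beyond)
  then have "lamps l = lamps l'" by (rule ext)
  ultimately show ?case using Cons.IH by simp
qed simp

lemma lamp_run_climb_position: "\<exists>f'. run lamp_act (climb l) (f, n) = Some (f', n + int (length l))"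
proof (induction l)
  case (Cons g l)
  obtain f' where "run lamp_act (climb l) (f, n) = Some (f', n + int (length l))"
    using Cons.IH by blast
  then show ?case
    by (cases "gen g") (auto simp: run_append gen_def shift_Cons)
qed simp

lemma R1_injective_M: "R1_injective P.M"
  unfolding R1_injective_def
proof (rule inj_onI)
  fix m m' assume m: "m \<in> R1_class P.M" and m': "m' \<in> R1_class P.M"
    and eq: "least_group_congruence P.M `` {m} = least_group_congruence P.M `` {m'}"
  obtain l where l: "set l \<subseteq> carrier G" "m = P.cl (climb l)" using R1_class_climb[OF m] by blast
  obtain l' where l': "set l' \<subseteq> carrier G" "m' = P.cl (climb l')" using R1_class_climb[OF m'] by blast
  have "\<one>\<^bsub>P.M\<^esub> \<in> idempotents P.M" by (simp add: idempotents_def)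
  then have "(m', m') \<in> least_group_congruence P.M"
    unfolding P.least_group_congruence_eq using l' by (auto simp: P.M_carrier)
  then have "(m, m') \<in> least_group_congruence P.M" using eq by blast
  then obtain f where "f \<in> idempotents P.M" "f \<otimes>\<^bsub>P.M\<^esub> m = f \<otimes>\<^bsub>P.M\<^esub> m'"
    unfolding P.least_group_congruence_eq by blast
  moreover from this obtain w where w: "f = P.cl w"
    by (auto simp: idempotents_def P.M_carrier)
  ultimately have f: "P.cl w \<in> idempotents P.M" "P.cl (w @ climb l) = P.cl (w @ climb l')"
    using l l' by (simp_all add: P.cl_append)
  have "run lamp_act (climb l) dark = run lamp_act (climb l') dark"
    using lamp_run_eq[OF f(2) dark_state] lamp_run_idempotent[OF f(1) dark_state]
    by (simp add: run_append)
  then have "l = l'" using lamp_run_climb l l' by (auto intro: lamps_inject)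
  then show "m = m'" using l l' by simp
qed

lemma Units_M: "Units P.M = {\<one>\<^bsub>P.M\<^esub>}"
proof (intro equalityI subsetI)
  fix m assume m: "m \<in> Units P.M"
  have R1: "x \<in> R1_class P.M" if "x \<in> Units P.M" for x
    using that Green_H_one[OF P.M_monoid] unfolding R1_class_def Green_H_def by blast
  let ?n = "inv\<^bsub>P.M\<^esub> m"
  obtain l where l: "m = P.cl (climb l)" using R1_class_climb[OF R1[OF m]] by blast
  obtain l' where l': "?n = P.cl (climb l')"
    using R1_class_climb[OF R1[OF P.Units_inv_Units[OF m]]] by blast
  have "P.cl (climb l @ climb l') = P.cl []"
    using P.Units_r_inv[OF m] l l' by (simp add: P.cl_append P.one_M)
  then have *: "run lamp_act (climb l @ climb l') dark = Some dark"
    using lamp_run_eq[OF _ dark_state] by fastforce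
  obtain f where f: "run lamp_act (climb l) dark = Some (f, int (length l))"
    using lamp_run_climb_position[of l "\<lambda>_. \<one>" 0] by auto
  obtain f' where "run lamp_act (climb l') (f, int (length l)) = Some (f', int (length l) + int (length l'))"
    using lamp_run_climb_position by blast
  then have "int (length l) + int (length l') = 0" using * f by (simp add: run_append)
  then have "length l = 0" by linarith
  then have "l = []" by simp
  then show "m \<in> {\<one>\<^bsub>P.M\<^esub>}" using l by (simp add: P.one_M)
qed simp

section \<open>The maximal subgroup\<close>

text \<open>
  From a base vertex \<open>h\<close>, the loop \<open>visit g\<close> goes to \<open>h g\<^sup>-\<^sup>1\<close>, against an incoming \<open>t\<close>-edge, and back;
  so \<open>e\<close> fixes precisely the vertices whose whole copy of \<open>G\<close> has incoming \<open>t\<close>-edges.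
\<close>

definition visit :: "'g \<Rightarrow> nat word" where
  "visit g = word_inverse (t @ a g) @ t @ a g"

definition visits :: "'g list \<Rightarrow> nat word" where
  "visits gs = concat (map visit gs)"

definition e :: "nat word" where
  "e = visits elems"

lemma visits_simps [simp]: "visits [] = []" "visits (g # gs) = visit g @ visits gs"
  by (simp_all add: visits_def)

lemma visit_idempotent: "P.cl (visit g) \<in> idempotents P.M"
  using P.cl_idempotent[of "t @ a g"] by (simp add: visit_def)

lemma visits_idempotent: "P.cl (visits gs) \<in> idempotents P.M"
proof (induction gs)
  case Nil
  show ?case by (simp add: idempotents_def flip: P.one_M)
next
  case (Cons g gs)
  then show ?case using P.idem_mult[OF visit_idempotent] by (simp add: P.cl_append)
qed

lemma visits_absorb_visit:
  "g \<in> set gs \<Longrightarrow> P.cl (visits gs @ visit g) = P.cl (visits gs)"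
proof (induction gs)
  case (Cons h gs)
  show ?case
  proof (cases "g \<in> set gs")
    case True
    from cl_context[OF Cons.IH[OF this], of "visit h" "[]"] show ?thesis by simp
  next
    case False
    then have h: "h = g" using Cons.prems by simp
    have "P.cl (visits gs @ visit g) = P.cl (visit g @ visits gs)"
      using P.idem_commute[OF visits_idempotent visit_idempotent] by (simp add: P.cl_append)
    from cl_context[OF this, of "visit g" "[]"]
    have "P.cl (visits (h # gs) @ visit g) = P.cl (visit g @ visit g @ visits gs)" by (simp add: h)
    also have "\<dots> = P.cl (visit g @ visits gs)"
      using cl_context[of "visit g @ visit g" "visit g" "[]" "visits gs"] P.idem[OF visit_idempotent]
      by (simp add: P.cl_append)
    finally show ?thesis by (simp add: h)
  qed
qed simp

lemma e_visit: "g \<in> carrier G \<Longrightarrow> P.cl (e @ visit g) = P.cl e"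
  using visits_absorb_visit[of g elems] by (simp add: e_def set_elems)

text \<open>
  As \<open>e\<close> absorbs \<open>visit g\<close>, which ends in \<open>t a(g)\<close>, a naming word behind \<open>e\<close> may be treated as if
  it stood behind \<open>t a(g)\<close>. The freedom in \<open>g\<close> is what makes \<open>e a(g)\<close> absorb \<open>e\<close> again.
\<close>

lemma e_shift_eq:
  assumes g: "g \<in> carrier G"
  shows "P.cl (e @ shift u) = P.cl (e @ word_inverse (t @ a g) @ t @ a (g \<otimes> evaluate u))"
proof -
  have "P.cl (e @ shift u) = P.cl ((e @ word_inverse (t @ a g)) @ t @ shift (gen g @ u))"
    using cl_context[OF e_visit[OF g], of "[]" "shift u"] by (simp add: visit_def)
  also have "\<dots> = P.cl ((e @ word_inverse (t @ a g)) @ t @ a (g \<otimes> evaluate u))"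
    using cl_context[OF t_absorbs[of "gen g @ u" "gen (g \<otimes> evaluate u)"], of "e @ word_inverse (t @ a g)" "[]"] g
    by simp
  finally show ?thesis by simp
qed

lemma e_shift_cong: "evaluate u = evaluate w \<Longrightarrow> P.cl (e @ shift u) = P.cl (e @ shift w)"
  using e_shift_eq[OF one_closed] by simp

lemma e_shift_visit:
  assumes h: "h \<in> carrier G"
  shows "P.cl (e @ shift u @ visit h) = P.cl (e @ shift u)"
proof -
  \<comment> \<open>Chosen such that \<open>a(?g) u\<close> has value \<open>h\<close>.\<close>
  let ?g = "h \<otimes> inv evaluate u"
  let ?z = "e @ word_inverse (t @ a ?g)"
  have z: "P.cl (e @ shift u) = P.cl (?z @ t @ a h)"
    using e_shift_eq[of ?g u] h by (simp add: m_assoc)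
  have "P.cl (e @ shift u @ visit h) = P.cl (?z @ t @ a h @ visit h)"
    using cl_context[OF z, of "[]" "visit h"] by simp
  also have "\<dots> = P.cl (?z @ t @ a h)"
    using cl_context[OF P.cl_cancel[of "t @ a h"], of ?z "[]"] by (simp add: visit_def)
  finally show ?thesis using z by simp
qed

lemma e_shift_e: "P.cl (e @ shift u @ e) = P.cl (e @ shift u)"
proof -
  have "P.cl (e @ shift u @ visits gs) = P.cl (e @ shift u)" if "set gs \<subseteq> carrier G" for gs
    using that
  proof (induction gs)
    case (Cons g gs)
    then show ?case
      using cl_context[OF e_shift_visit[of g u], of "[]" "visits gs"] by simp
  qed simp
  then show ?thesis by (simp add: set_elems e_def)
qed

lemma e_shift_t: "P.cl (e @ shift u @ t_inv @ t) = P.cl (e @ shift u)"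
proof -
  have "P.cl (t @ a \<one>) = P.cl t" using t_absorbs[of "gen \<one>" "[]"] by simp
  moreover from this have "P.cl (word_inverse (t @ a \<one>)) = P.cl t_inv"
    using P.cl_word_inverse_cong[of "t @ a \<one>" t] by simp
  ultimately have "P.cl (visit \<one>) = P.cl (t_inv @ t)"
    unfolding visit_def by (metis P.cl_append UNIV_I words_UNIV)
  from cl_context[OF this, of "e @ shift u" "[]"] e_shift_visit[OF one_closed, of u]
  show ?thesis by simp
qed

lemma e_mult:
  "P.cl (e @ shift u) \<otimes>\<^bsub>P.M\<^esub> P.cl (e @ shift w) = P.cl (e @ shift (u @ w))"
  using cl_context[OF e_shift_e[of u], of "[]" "shift w"] by (simp flip: P.cl_append)

definition embed :: "'g \<Rightarrow> nat word set set" where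
  "embed g = P.cl (e @ a g)"

lemma e_idempotent: "P.cl e \<in> idempotents P.M"
  unfolding e_def by (rule visits_idempotent)

lemma embed_one: "embed \<one> = P.cl e"
  using e_shift_cong[of "gen \<one>" "[]"] by (simp add: embed_def)

lemma embed_mult: "g \<in> carrier G \<Longrightarrow> h \<in> carrier G \<Longrightarrow> embed g \<otimes>\<^bsub>P.M\<^esub> embed h = embed (g \<otimes> h)"
  unfolding embed_def e_mult by (rule e_shift_cong) simp

lemma embed_Green_H:
  assumes g: "g \<in> carrier G"
  shows "(P.cl e, embed g) \<in> Green_H P.M"
proof (rule P.Green_H_I)
  show "embed g \<otimes>\<^bsub>P.M\<^esub> embed (inv g) = P.cl e" "embed (inv g) \<otimes>\<^bsub>P.M\<^esub> embed g = P.cl e"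
    "P.cl e \<otimes>\<^bsub>P.M\<^esub> embed g = embed g" "embed g \<otimes>\<^bsub>P.M\<^esub> P.cl e = embed g"
    using g by (simp_all add: embed_mult flip: embed_one)
qed (auto simp: embed_def P.M_carrier)

text \<open>In the lamplighter group \<open>e\<close> becomes trivial, and \<open>a(g)\<close> leaves \<open>g\<close> at the lamp \<open>0\<close>.\<close>

lemma embed_inj: "inj_on embed (carrier G)"
proof (rule inj_onI)
  fix g h assume gh: "g \<in> carrier G" "h \<in> carrier G" "embed g = embed h"
  have "run lamp_act (e @ a k) dark = Some ((\<lambda>_. \<one>)(0 := k), 0)" if "k \<in> carrier G" for k
    using that by (simp add: run_append lamp_run_idempotent[OF e_idempotent dark_state] lamp_run_shift)
  then have "(\<lambda>_. \<one>)(0 := g) = ((\<lambda>_. \<one>)(0 := h) :: int \<Rightarrow> 'g)"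
    using gh lamp_run_eq[OF _ dark_state, of "e @ a g" "e @ a h"] by (simp add: embed_def)
  then show "g = h" by (metis fun_upd_same)
qed

lemma run_visit:
  assumes v: "run (vertex_act A) e v = Some v'" and A: "A \<subseteq> carrier G" "v \<in> vertices A"
    and g: "g \<in> carrier G"
  shows "run (vertex_act A) (visit g) v \<noteq> None"
proof -
  interpret partial_injection_action "vertex_act A" "vertices A" by (rule vertex_action[OF A(1)])
  have idem: "run (vertex_act A) (visit h) v = None \<or> run (vertex_act A) (visit h) v = Some v" for h
    using run_idempotent[OF A(2), of "word_inverse (t @ a h)"] by (auto simp: visit_def)
  have "run (vertex_act A) (visits gs) v = Some v' \<Longrightarrow> g \<in> set gs \<Longrightarrow>
      run (vertex_act A) (visit g) v \<noteq> None" for gs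
  proof (induction gs)
    case (Cons h gs)
    then show ?case using idem[of h] by (auto simp: run_append)
  qed simp
  then show ?thesis using v g set_elems by (simp add: e_def)
qed

lemma run_e: "run (vertex_act (carrier G)) e (Node \<one> []) = Some (Node \<one> [])"
proof -
  have ev: "evaluate (word_inverse (gen g)) = inv g" if "g \<in> carrier G" for g
    using that by simp
  have "run (vertex_act (carrier G)) (visits gs) (Node \<one> []) = Some (Node \<one> [])"
    if "set gs \<subseteq> carrier G" for gs
    using that
    by (induction gs) (auto simp: run_append visit_def run_shift simp del: evaluate_word_inverse simp: ev)
  then show ?thesis by (simp add: e_def set_elems)
qed

text \<open>
  An element \<open>m\<close> of the \<open>\<H>\<close>-class of \<open>e\<close> is a path from \<open>Node \<one> []\<close> to some vertex \<open>v\<close>, which spells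
  \<open>m\<close>. As \<open>m\<^sup>-\<^sup>1 m = e\<close>, also \<open>e\<close> is defined at \<open>v\<close>, and this forces \<open>v\<close> into the base: roots have no
  edges with naming letters, and in an upper copy the loop \<open>visit k\<close> at \<open>g\<close> is defined only
  for \<open>k = g\<close>. The latter excludes upper copies only if \<open>G\<close> has a second element.
\<close>

lemma Green_H_embed:
  assumes nontrivial: "carrier G \<noteq> {\<one>}" and m: "(P.cl e, m) \<in> Green_H P.M"
  shows "m \<in> embed ` carrier G"
proof -
  have "m \<in> carrier P.M" using m by (auto simp: Green_H_def Green_R_def)
  then obtain w where w: "m = P.cl w" by (auto simp: P.M_carrier)
  have "m \<otimes>\<^bsub>P.M\<^esub> minv P.M m = P.cl e" "minv P.M m \<otimes>\<^bsub>P.M\<^esub> m = P.cl e"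
    using m P.Green_R_idempotent P.Green_L_idempotent e_idempotent by (auto simp: Green_H_def)
  then have ww: "P.cl (w @ word_inverse w) = P.cl e" "P.cl (word_inverse w @ w) = P.cl e"
    by (simp_all add: w P.minv_cl P.cl_append)
  let ?A = "carrier G"
  have A: "?A \<subseteq> carrier G" by simp
  interpret partial_injection_action "vertex_act ?A" "vertices ?A" by (rule vertex_action[OF A])
  have one: "Node \<one> [] \<in> vertices ?A" by simp
  have "run (vertex_act ?A) (w @ word_inverse w) (Node \<one> []) = Some (Node \<one> [])"
    using vertex_run_eq[OF A ww(1) one] run_e by simp
  then obtain v where v: "run (vertex_act ?A) w (Node \<one> []) = Some v"
    by (auto simp: run_append bind_eq_Some_conv)
  have vA: "v \<in> vertices ?A" by (rule run_closed[OF v one])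
  let ?r = "\<lambda>g. e @ a g @ t_inv" and ?b = "\<lambda>g. e @ a g"
  have "P.cl (spell ?r ?b (Node \<one> []) @ w) = P.cl (spell ?r ?b v)"
  proof (rule spell_run[OF A _ _ _ one v])
    show "P.cl (?r g @ t) = P.cl (?b g)" for g using e_shift_t[of "gen g"] by simp
    show "P.cl (?b g @ shift [c]) = P.cl (?b (g \<otimes> letter_value c))" if "g \<in> carrier G" for g c
      using that e_shift_cong[of "gen g @ [c]" "gen (g \<otimes> letter_value c)"] by simp
  qed simp
  also have "P.cl (spell ?r ?b (Node \<one> []) @ w) = P.cl (e @ w)"
    using cl_context[of "e @ a \<one>" e "[]" w] embed_one by (simp add: embed_def)
  also have "\<dots> = P.cl ((w @ word_inverse w) @ w)"
    using cl_context[OF ww(1), of "[]" w] by simp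
  also have "\<dots> = m" using P.cl_cancel[of w] w by simp
  finally have m_eq: "m = P.cl (spell ?r ?b v)" .
  have "run (vertex_act ?A) (word_inverse w @ w) v = Some v"
    using run_word_inverse_Some[OF v one] v by (simp add: run_append)
  then have ev: "run (vertex_act ?A) e v = Some v"
    using vertex_run_eq[OF A ww(2) vA] by simp
  note visit = run_visit[OF ev A vA]
  show ?thesis
  proof (cases v)
    case (Root g)
    then show ?thesis using visit[of \<one>] by (simp add: visit_def gen_def shift_Cons)
  next
    case (Node g l)
    have g: "g \<in> carrier G" using vA Node by simp
    show ?thesis
    proof (cases l)
      case Nil
      then show ?thesis using m_eq Node g by (auto simp: embed_def)
    next
      case (Cons h l')
      have "k = g" if k: "k \<in> carrier G" for k
      proof -
        have "g \<otimes> inv k = \<one>"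
          using visit[OF k] k g Node Cons by (auto simp: visit_def run_append run_shift split: if_splits)
        then show ?thesis using k g by (metis inv_closed inv_equality inv_inv)
      qed
      then have "carrier G = {\<one>}" using one_closed by blast
      then show ?thesis using nontrivial by simp
    qed
  qed
qed

lemma maximal_subgroup_iso:
  assumes "carrier G \<noteq> {\<one>}"
  shows "maximal_subgroup P.M (P.cl e) \<cong> G"
proof (rule iso_sym)
  have "embed \<in> hom G (maximal_subgroup P.M (P.cl e))"
    using embed_Green_H embed_mult by (auto simp: hom_def maximal_subgroup_def)
  moreover have "bij_betw embed (carrier G) (carrier (maximal_subgroup P.M (P.cl e)))"
    using embed_inj embed_Green_H Green_H_embed[OF assms]
    by (auto simp: bij_betw_def maximal_subgroup_def)
  ultimately show "G \<cong> maximal_subgroup P.M (P.cl e)"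
    unfolding is_iso_def iso_def by blast
qed

lemma trivial_maximal_subgroup_iso:
  assumes "carrier G = {\<one>}"
  shows "maximal_subgroup P.M \<one>\<^bsub>P.M\<^esub> \<cong> G"
proof -
  have "carrier (maximal_subgroup P.M \<one>\<^bsub>P.M\<^esub>) = {\<one>\<^bsub>P.M\<^esub>}"
    using Green_H_one[OF P.M_monoid] Units_M by (simp add: maximal_subgroup_def)
  then have "(\<lambda>_. \<one>) \<in> iso (maximal_subgroup P.M \<one>\<^bsub>P.M\<^esub>) G"
    using assms by (auto simp: iso_def hom_def bij_betw_def)
  then show ?thesis by (auto simp: is_iso_def)
qed

lemma special_inverse_monoid_M: "special_inverse_monoid TYPE(nat) P.M"
proof -
  have "special_presentation UNIV relators"
    by (auto simp: special_presentation_def relators_def)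
  moreover have "P.M \<cong> P.M" by (rule iso_refl)
  ultimately show ?thesis
    unfolding special_inverse_monoid_def using P.inverse_monoid_M by blast
qed

end

theorem theorem6p1:
  fixes G :: "('g, 'h) monoid_scheme"
  assumes "group G" and "finite (carrier G)"
  shows "\<exists>M :: nat word set set monoid.
           special_inverse_monoid TYPE(nat) M \<and>
           R1_injective M \<and>
           Units M = {\<one>\<^bsub>M\<^esub>} \<and>
           (\<exists>e\<in>idempotents M. maximal_subgroup M e \<cong> G)"
proof -
  obtain elems where "set elems = carrier G" using finite_list[OF assms(2)] by blast
  then interpret enumerated_group G elems
    by (intro enumerated_group.intro assms(1) enumerated_group_axioms.intro)
  have "\<exists>e\<in>idempotents P.M. maximal_subgroup P.M e \<cong> G"
  proof (cases "carrier G = {\<one>\<^bsub>G\<^esub>}")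
    case True
    have "\<one>\<^bsub>P.M\<^esub> \<in> idempotents P.M" by (simp add: idempotents_def)
    then show ?thesis using trivial_maximal_subgroup_iso[OF True] by blast
  next
    case False
    then show ?thesis using maximal_subgroup_iso e_idempotent by blast
  qed
  then show ?thesis using special_inverse_monoid_M R1_injective_M Units_M by blast
qed

end
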